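(* Suppose the standing assumptions (A1)–(A3) of the context hold, $\{x_k\}$ is an infinite sequence generated by the SQP algorithm of the context, MFCQ is satisfied at all accumulation points of $\{x_k\}$, and the constraint functions $c_i$, $i\in\mathcal E\cup\mathcal I$, are affine. Let $b\ge\sigma\ge\rho$ and $2b\ge\sigma+l$. If the potential function $L$ is a KL function with exponent $\alpha\in(0,\frac12]$, then there exist $q_0\in(0,1)$ and $q_1>0$ such that for all $k$ large enough $\|x_k-\bar x\|\le q_1q_0^k$, where $\bar x$ is the limit of $\{x_k\}$ ($x_k\to\bar x$).
   Context: Problem: $\mathcal E,\mathcal I$ are finite disjoint index sets, $m=|\mathcal E|+|\mathcal I|$, $c_i:\mathbb{R}^n\to\mathbb{R}$ for $i\in\mathcal E\cup\mathcal I$, $f:\mathbb{R}^n\to\mathbb{R}\cup\{+\infty\}$. Minimize $f(x)$ subject to $c_i(x)=0$ ($i\in\mathcal E$), $c_i(x)\ge0$ ($i\in\mathcal I$); the feasible set is $\Omega$. Notation: $[y]^-=\max\{0,-y\}$, $v(x)=\sum_{i\in\mathcal E}|c_i(x)|+\sum_{i\in\mathcal I}[c_i(x)]^-$, merit function $\phi(x,\theta)=f(x)+\theta v(x)$; $\bar\partial f$ is the Clarke subdifferential; $\|\cdot\|$ is the Euclidean norm. $f$ is upper-$C^2$ on an open set $O$ if near each point of $O$ it can be written $f(x)=\min_{t\in T}f_t(x)$ with $T$ a compact space, each $f_t$ of class $C^2$, and $f_t$ and its partial derivatives in $x$ up to order 2 jointly continuous in $(t,x)$. SQP algorithm: given $x_0$,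 $\theta_0>0$, $\eta\in(0,1)$, $\tau_\alpha\in(0,1)$, $\gamma>0$ (stopping tolerances zero: it stops only if $d_k=0$ and $v(x_k)=0$). At iteration $k$: take any $g_k\in\bar\partial f(x_k)$ and a symmetric matrix $B_k$; let $(d_k,v^k,w^k,t^k)$ solve $$\min_{d,v,w,t} f(x_k)+g_k^Td+\tfrac12 d^TB_kd+\theta_k\sum_{i\in\mathcal E}(v_i+w_i)+\theta_k\sum_{i\in\mathcal I}t_i$$ s.t. $c_i(x_k)+\nabla c_i(x_k)^Td=v_i-w_i$ ($i\in\mathcal E$), $c_i(x_k)+\nabla c_i(x_k)^Td\ge -t_i$ ($i\in\mathcal I$), $v,w,t\ge0$. Let $\lambda^{k+1}\in\mathbb{R}^m$ be the Lagrange multiplier of the linearized constraints, i.e. with some $p^{k+1},q^{k+1},r^{k+1}\ge0$: $g_k+B_kd_k-\sum_{i}\lambda_i^{k+1}\nabla c_i(x_k)=0$; $\lambda_i^{k+1}\ge0$ and $\lambda_i^{k+1}[c_i(x_k)+\nabla c_i(x_k)^Td_k+t_i^k]=0$ for $i\in\mathcal I$; $\theta_k+\lambda_i^{k+1}=p_i^{k+1}$, $\theta_k-\lambda_i^{k+1}=q_i^{k+1}$, $p_i^{k+1}v_i^k=q_i^{k+1}w_i^k=0$ for $i\in\mathcal E$; $\theta_k-\lambda_i^{k+1}=r_i^{k+1}$, $r_i^{k+1}t_i^k=0$ for $i\in\mathcal I$. Set $\theta_{k+1}=\max\{\theta_k,\|\lambda^{k+1}\|_\infty+\gamma\}$. Let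 $\alpha_k$ be the first of $1,\tau_\alpha,\tau_\alpha^2,\dots$ such that $\phi(x_k,\theta_k)-\phi(x_k+\alpha_kd_k,\theta_k)\ge\eta\alpha_k\tfrac12d_k^TB_kd_k$; set $x_{k+1}=x_k+\alpha_kd_k$. Standing assumptions. (A1) $f$ is (finite,) Lipschitz continuous and upper-$C^2$ on an open set containing the compact convex set $D$ of (A3); $\rho>0$ is a constant such that $-f+\frac\rho2\|\cdot\|^2$ is convex on $D$ and $f(x)-f(\bar x)-\langle g,x-\bar x\rangle\le\frac\rho2\|x-\bar x\|^2$ for all $x,\bar x\in D$, $g\in\bar\partial f(\bar x)$. (A2) Each $c_i$ is continuously differentiable with Lipschitz gradient, and $H\ge0$ satisfies $|c_i(x')-c_i(x)-\nabla c_i(x)^T(x'-x)|\le\frac H2\|x-x'\|^2$ for all $x,x'$ and all $i$. (A3) There is a compact convex set $D\subset\mathbb{R}^n$ with $\Omega\subseteq D$ and $x_k,\,x_k+d_k\in D$ for all $k$; the $B_k$ are symmetric, uniformly bounded, and for some $b>0$, $d^TB_kd\ge b\|d\|^2$ for all $k$ and $d\in\mathbb{R}^n$. MFCQ: for a feasible point $x$ let $\mathcal A(x)=\mathcal E\cup\{i\in\mathcal I: c_i(x)=0\}$. MFCQ holds at $x$ if $\nabla c_i(x)$, $i\in\mathcal E$, are linearly independent and there is $w\in\mathbb{R}^n$ with $\nabla c_i(x)^Tw>0$ for all $i\in\mathcal A(x)\cap\mathcal I$ and $\nabla c_i(x)^Tw=0$ for all $i\in\mathcal E$ (so MFCQ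 is a condition on feasible points). Potential function: $\sigma>0$, $l>0$ are constants; $F(x)=-f(x)+\frac12\sigma\|x\|^2$ for $x\in D$ and $F(x)=+\infty$ otherwise, with $\sigma$ such that $F$ is convex; $F^*(u)=\sup_x\{\langle u,x\rangle-F(x)\}$. Let $\bar c_i(x,w)=c_i(w)+\nabla c_i(w)^T(x-w)$, $\bar C=\{(x,w):\bar c_i(x,w)=0\ (i\in\mathcal E),\ \bar c_i(x,w)\ge0\ (i\in\mathcal I)\}$, and $i_{\bar C}$ its indicator function ($0$ on $\bar C$, $+\infty$ elsewhere). For $(x,y,w)\in(\mathbb{R}^n)^3$, $L(x,y,w)=-y^Tx+F^*(y)+\tfrac12\sigma\|x\|^2+\tfrac12 l\|x-w\|^2+i_{\bar C}(x,w)$. KL: $\partial$ denotes the limiting (general) subdifferential, $\mathrm{dom}\,\partial h=\{x:\partial h(x)\ne\emptyset\}$. A function $h$ has the KL property at $\hat x\in\mathrm{dom}\,\partial h$ if there are $a\in(0,\infty]$, a neighborhood $U$ of $\hat x$ and a continuous concave $\varphi:[0,a)\to[0,\infty)$ with $\varphi(0)=0$, $\varphi\in C^1(0,a)$, $\varphi'>0$ on $(0,a)$, such that $\varphi'(h(x)-h(\hat x))\,\mathrm{dist}(0,\partial h(x))\ge1$ for all $x\in U$ with $h(\hat x)<h(x)<h(\hat x)+a$ (with $\mathrm{dist}(0,\emptyset)=+\infty$). $h$ is a KL function if this holds at each point of $\mathrm{dom}\,\partial h$, and a KL function with exponent $\alpha\in[0,1)$ if moreover $\varphi$ can be taken of the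 form $\varphi(s)=a_0s^{1-\alpha}$, $a_0>0$. *)

theory Defs
  imports "HOL-Analysis.Analysis"
begin

section \<open>Nonsmooth analysis\<close>

definition grad :: "('a::real_inner \<Rightarrow> real) \<Rightarrow> 'a \<Rightarrow> 'a" where
  "grad h x = (THE g. GDERIV h x :> g)"

definition affine_function :: "('a::real_inner \<Rightarrow> real) \<Rightarrow> bool" where
  "affine_function h \<longleftrightarrow> (\<exists>a \<beta>. \<forall>x. h x = inner a x + \<beta>)"

text \<open>Clarke's generalized directional derivative and subdifferential. They are meant for points
  near which \<open>f\<close> is finite and Lipschitz, so that the difference quotients are eventually real.\<close>

definition clarke_derivative :: "('a::euclidean_space \<Rightarrow> ereal) \<Rightarrow> 'a \<Rightarrow> 'a \<Rightarrow> ereal" where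
  "clarke_derivative f x u =
     Limsup (nhds x \<times>\<^sub>F at_right (0::real)) (\<lambda>(y, s). (f (y + s *\<^sub>R u) - f y) / ereal s)"

definition clarke_subdifferential :: "('a::euclidean_space \<Rightarrow> ereal) \<Rightarrow> 'a \<Rightarrow> 'a set" where
  "clarke_subdifferential f x = {g. \<forall>u. ereal (inner g u) \<le> clarke_derivative f x u}"

definition regular_subdifferential :: "('a::euclidean_space \<Rightarrow> ereal) \<Rightarrow> 'a \<Rightarrow> 'a set" where
  "regular_subdifferential h x =
     {v. \<bar>h x\<bar> \<noteq> \<infinity> \<and>
         0 \<le> Liminf (at x) (\<lambda>y. (h y - h x - ereal (inner v (y - x))) / ereal (norm (y - x)))}"

definition limiting_subdifferential :: "('a::euclidean_space \<Rightarrow> ereal) \<Rightarrow> 'a \<Rightarrow> 'a set" where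
  "limiting_subdifferential h x =
     {v. \<bar>h x\<bar> \<noteq> \<infinity> \<and>
         (\<exists>xs vs. xs \<longlonglongrightarrow> x \<and> (\<lambda>n. h (xs n)) \<longlonglongrightarrow> h x \<and>
                  (\<forall>n. vs n \<in> regular_subdifferential h (xs n)) \<and> vs \<longlonglongrightarrow> v)}"

text \<open>The parameter space is an arbitrary compact topology on a subset of the type \<open>'t\<close>, which may
  vary with the point \<open>z\<close>. The functions \<open>G t\<close> and \<open>Q t\<close> are the gradient and the Hessian matrix
  of \<open>\<psi> t\<close>, so that joint continuity of \<open>\<psi>\<close>, \<open>G\<close> and \<open>Q\<close> is joint continuity of all partial
  derivatives in \<open>x\<close> up to order 2.\<close>

definition upper_C2_on :: "'t itself \<Rightarrow> (real^'n \<Rightarrow> ereal) \<Rightarrow> (real^'n) set \<Rightarrow> bool" where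
  "upper_C2_on _ f U \<longleftrightarrow>
     (\<forall>z\<in>U. \<exists>V (T :: 't topology) (\<psi> :: 't \<Rightarrow> real^'n \<Rightarrow> real) G (Q :: 't \<Rightarrow> real^'n \<Rightarrow> real^'n^'n).
        open V \<and> z \<in> V \<and> V \<subseteq> U \<and> compact_space T \<and>
        (\<forall>x\<in>V. (\<exists>t\<in>topspace T. f x = ereal (\<psi> t x)) \<and> (\<forall>t\<in>topspace T. f x \<le> ereal (\<psi> t x))) \<and>
        (\<forall>t\<in>topspace T. \<forall>x\<in>V. GDERIV (\<psi> t) x :> G t x) \<and>
        (\<forall>t\<in>topspace T. \<forall>x\<in>V. (G t has_derivative (\<lambda>h. Q t x *v h)) (at x)) \<and>
        continuous_map (prod_topology T (top_of_set V)) euclidean (\<lambda>(t, x). \<psi> t x) \<and>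
        continuous_map (prod_topology T (top_of_set V)) euclidean (\<lambda>(t, x). G t x) \<and>
        continuous_map (prod_topology T (top_of_set V)) euclidean (\<lambda>(t, x). Q t x))"

definition convex_extended :: "('a::real_vector \<Rightarrow> ereal) \<Rightarrow> bool" where
  "convex_extended h \<longleftrightarrow> convex {(x, r :: real). h x \<le> ereal r}"

definition conjugate :: "('a::real_inner \<Rightarrow> ereal) \<Rightarrow> 'a \<Rightarrow> ereal" where
  "conjugate h u = (SUP x. ereal (inner u x) - h x)"

section \<open>The Kurdyka-Lojasiewicz property\<close>

text \<open>The infimum over the empty set is \<open>\<infinity>\<close>.\<close>

definition dist_zero :: "'a::real_normed_vector set \<Rightarrow> ereal" where
  "dist_zero S = (INF v\<in>S. ereal (norm v))"

definition desingularizing :: "ereal \<Rightarrow> (real \<Rightarrow> real) \<Rightarrow> bool" where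
  "desingularizing a \<phi> \<longleftrightarrow>
     continuous_on {s. 0 \<le> s \<and> ereal s < a} \<phi> \<and> concave_on {s. 0 \<le> s \<and> ereal s < a} \<phi> \<and>
     (\<forall>s. 0 \<le> s \<and> ereal s < a \<longrightarrow> 0 \<le> \<phi> s) \<and> \<phi> 0 = 0 \<and>
     (\<forall>s. 0 < s \<and> ereal s < a \<longrightarrow> \<phi> differentiable (at s) \<and> 0 < deriv \<phi> s) \<and>
     continuous_on {s. 0 < s \<and> ereal s < a} (deriv \<phi>)"

definition kl_property_with ::
    "('a::euclidean_space \<Rightarrow> ereal) \<Rightarrow> 'a \<Rightarrow> (real \<Rightarrow> real) \<Rightarrow> bool" where
  "kl_property_with h z \<phi> \<longleftrightarrow>
     (\<exists>a U. 0 < a \<and> open U \<and> z \<in> U \<and> desingularizing a \<phi> \<and>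
        (\<forall>x\<in>U. h z < h x \<and> h x < h z + a \<longrightarrow>
           1 \<le> ereal (deriv \<phi> (real_of_ereal (h x - h z))) * dist_zero (limiting_subdifferential h x)))"

definition kl_function :: "('a::euclidean_space \<Rightarrow> ereal) \<Rightarrow> bool" where
  "kl_function h \<longleftrightarrow>
     (\<forall>z. limiting_subdifferential h z \<noteq> {} \<longrightarrow> (\<exists>\<phi>. kl_property_with h z \<phi>))"

definition kl_function_exponent :: "('a::euclidean_space \<Rightarrow> ereal) \<Rightarrow> real \<Rightarrow> bool" where
  "kl_function_exponent h \<alpha> \<longleftrightarrow> kl_function h \<and> 0 \<le> \<alpha> \<and> \<alpha> < 1 \<and>
     (\<forall>z. limiting_subdifferential h z \<noteq> {} \<longrightarrow>
        (\<exists>a0>0. kl_property_with h z (\<lambda>s. a0 * s powr (1 - \<alpha>))))"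

section \<open>The constrained problem\<close>

definition feasible_set ::
    "('i \<Rightarrow> real^'n \<Rightarrow> real) \<Rightarrow> 'i set \<Rightarrow> 'i set \<Rightarrow> (real^'n) set" where
  "feasible_set c E I = {x. (\<forall>i\<in>E. c i x = 0) \<and> (\<forall>i\<in>I. 0 \<le> c i x)}"

definition violation ::
    "('i \<Rightarrow> real^'n \<Rightarrow> real) \<Rightarrow> 'i set \<Rightarrow> 'i set \<Rightarrow> real^'n \<Rightarrow> real" where
  "violation c E I x = (\<Sum>i\<in>E. \<bar>c i x\<bar>) + (\<Sum>i\<in>I. max 0 (- c i x))"

definition merit ::
    "(real^'n \<Rightarrow> ereal) \<Rightarrow> ('i \<Rightarrow> real^'n \<Rightarrow> real) \<Rightarrow> 'i set \<Rightarrow> 'i set \<Rightarrow> real^'n \<Rightarrow> real \<Rightarrow> ereal" where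
  "merit f c E I x \<theta> = f x + ereal (\<theta> * violation c E I x)"

text \<open>Feasibility is part of the condition: MFCQ holds only at feasible points. Linear independence
  is that of the indexed family of gradients, hence the injectivity.\<close>

definition mfcq ::
    "('i \<Rightarrow> real^'n \<Rightarrow> real) \<Rightarrow> 'i set \<Rightarrow> 'i set \<Rightarrow> real^'n \<Rightarrow> bool" where
  "mfcq c E I x \<longleftrightarrow> x \<in> feasible_set c E I \<and>
     inj_on (\<lambda>i. grad (c i) x) E \<and> independent ((\<lambda>i. grad (c i) x) ` E) \<and>
     (\<exists>w. (\<forall>i\<in>I. c i x = 0 \<longrightarrow> 0 < inner (grad (c i) x) w) \<and>
          (\<forall>i\<in>E. inner (grad (c i) x) w = 0))"

definition accumulation_point :: "(nat \<Rightarrow> 'a::topological_space) \<Rightarrow> 'a \<Rightarrow> bool" where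
  "accumulation_point x z \<longleftrightarrow> (\<exists>r. strict_mono r \<and> (x \<circ> r) \<longlonglongrightarrow> z)"

section \<open>The SQP algorithm\<close>

text \<open>\<open>c_lin c i x w\<close> is the linearization of \<open>c i\<close> at \<open>w\<close>, evaluated at \<open>x\<close>.\<close>

definition c_lin :: "('i \<Rightarrow> real^'n \<Rightarrow> real) \<Rightarrow> 'i \<Rightarrow> real^'n \<Rightarrow> real^'n \<Rightarrow> real" where
  "c_lin c i x w = c i w + inner (grad (c i) w) (x - w)"

definition qp_feasible ::
    "('i \<Rightarrow> real^'n \<Rightarrow> real) \<Rightarrow> 'i set \<Rightarrow> 'i set \<Rightarrow> real^'n \<Rightarrow>
     real^'n \<Rightarrow> ('i \<Rightarrow> real) \<Rightarrow> ('i \<Rightarrow> real) \<Rightarrow> ('i \<Rightarrow> real) \<Rightarrow> bool" where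
  "qp_feasible c E I x d v w t \<longleftrightarrow>
     (\<forall>i\<in>E. c i x + inner (grad (c i) x) d = v i - w i \<and> 0 \<le> v i \<and> 0 \<le> w i) \<and>
     (\<forall>i\<in>I. c i x + inner (grad (c i) x) d \<ge> - t i \<and> 0 \<le> t i)"

definition qp_objective ::
    "(real^'n \<Rightarrow> ereal) \<Rightarrow> 'i set \<Rightarrow> 'i set \<Rightarrow> real^'n \<Rightarrow> real^'n \<Rightarrow> real^'n^'n \<Rightarrow> real \<Rightarrow>
     real^'n \<Rightarrow> ('i \<Rightarrow> real) \<Rightarrow> ('i \<Rightarrow> real) \<Rightarrow> ('i \<Rightarrow> real) \<Rightarrow> ereal" where
  "qp_objective f E I x g B \<theta> d v w t =
     f x + ereal (inner g d + 1/2 * inner d (B *v d) + \<theta> * (\<Sum>i\<in>E. v i + w i) + \<theta> * (\<Sum>i\<in>I. t i))"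

definition qp_solution ::
    "(real^'n \<Rightarrow> ereal) \<Rightarrow> ('i \<Rightarrow> real^'n \<Rightarrow> real) \<Rightarrow> 'i set \<Rightarrow> 'i set \<Rightarrow>
     real^'n \<Rightarrow> real^'n \<Rightarrow> real^'n^'n \<Rightarrow> real \<Rightarrow>
     real^'n \<Rightarrow> ('i \<Rightarrow> real) \<Rightarrow> ('i \<Rightarrow> real) \<Rightarrow> ('i \<Rightarrow> real) \<Rightarrow> bool" where
  "qp_solution f c E I x g B \<theta> d v w t \<longleftrightarrow>
     qp_feasible c E I x d v w t \<and>
     (\<forall>d' v' w' t'. qp_feasible c E I x d' v' w' t' \<longrightarrow>
        qp_objective f E I x g B \<theta> d v w t \<le> qp_objective f E I x g B \<theta> d' v' w' t')"

definition qp_multiplier ::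
    "('i \<Rightarrow> real^'n \<Rightarrow> real) \<Rightarrow> 'i set \<Rightarrow> 'i set \<Rightarrow>
     real^'n \<Rightarrow> real^'n \<Rightarrow> real^'n^'n \<Rightarrow> real \<Rightarrow>
     real^'n \<Rightarrow> ('i \<Rightarrow> real) \<Rightarrow> ('i \<Rightarrow> real) \<Rightarrow> ('i \<Rightarrow> real) \<Rightarrow> ('i \<Rightarrow> real) \<Rightarrow> bool" where
  "qp_multiplier c E I x g B \<theta> d v w t lam \<longleftrightarrow>
     g + B *v d - (\<Sum>i\<in>E \<union> I. lam i *\<^sub>R grad (c i) x) = 0 \<and>
     (\<forall>i\<in>I. 0 \<le> lam i \<and> lam i * (c i x + inner (grad (c i) x) d + t i) = 0) \<and>
     (\<exists>p q r.
        (\<forall>i\<in>E. 0 \<le> p i \<and> 0 \<le> q i \<and> \<theta> + lam i = p i \<and> \<theta> - lam i = q i \<and>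
                p i * v i = 0 \<and> q i * w i = 0) \<and>
        (\<forall>i\<in>I. 0 \<le> r i \<and> \<theta> - lam i = r i \<and> r i * t i = 0))"

text \<open>Inserting \<open>0\<close> changes nothing unless \<open>S\<close> is empty, where the norm is \<open>0\<close>.\<close>

definition max_norm :: "'i set \<Rightarrow> ('i \<Rightarrow> real) \<Rightarrow> real" where
  "max_norm S lam = Max (insert 0 ((\<lambda>i. \<bar>lam i\<bar>) ` S))"

definition sufficient_decrease ::
    "(real^'n \<Rightarrow> ereal) \<Rightarrow> ('i \<Rightarrow> real^'n \<Rightarrow> real) \<Rightarrow> 'i set \<Rightarrow> 'i set \<Rightarrow> real \<Rightarrow>
     real^'n \<Rightarrow> real \<Rightarrow> real^'n \<Rightarrow> real^'n^'n \<Rightarrow> real \<Rightarrow> bool" where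
  "sufficient_decrease f c E I \<eta> x \<theta> d B a \<longleftrightarrow>
     merit f c E I x \<theta> - merit f c E I (x + a *\<^sub>R d) \<theta> \<ge> ereal (\<eta> * a * (1/2) * inner d (B *v d))"

text \<open>An infinite run of the algorithm: the stopping test fails at every iteration. The multiplier
  computed in iteration \<open>k\<close> is \<open>lam (Suc k)\<close>; the value \<open>lam 0\<close> is irrelevant.\<close>

definition sqp_run ::
    "(real^'n \<Rightarrow> ereal) \<Rightarrow> ('i \<Rightarrow> real^'n \<Rightarrow> real) \<Rightarrow> 'i set \<Rightarrow> 'i set \<Rightarrow>
     real \<Rightarrow> real \<Rightarrow> real \<Rightarrow> real \<Rightarrow>
     (nat \<Rightarrow> real^'n) \<Rightarrow> (nat \<Rightarrow> real^'n) \<Rightarrow> (nat \<Rightarrow> real^'n^'n) \<Rightarrow> (nat \<Rightarrow> real^'n) \<Rightarrow>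
     (nat \<Rightarrow> 'i \<Rightarrow> real) \<Rightarrow> (nat \<Rightarrow> 'i \<Rightarrow> real) \<Rightarrow> (nat \<Rightarrow> 'i \<Rightarrow> real) \<Rightarrow>
     (nat \<Rightarrow> 'i \<Rightarrow> real) \<Rightarrow> (nat \<Rightarrow> real) \<Rightarrow> (nat \<Rightarrow> real) \<Rightarrow> bool" where
  "sqp_run f c E I \<theta>0 \<eta> \<tau> \<gamma> x g B d v w t lam \<theta> step \<longleftrightarrow>
     0 < \<theta>0 \<and> 0 < \<eta> \<and> \<eta> < 1 \<and> 0 < \<tau> \<and> \<tau> < 1 \<and> 0 < \<gamma> \<and> \<theta> 0 = \<theta>0 \<and>
     (\<forall>k. g k \<in> clarke_subdifferential f (x k) \<and>
          transpose (B k) = B k \<and>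
          qp_solution f c E I (x k) (g k) (B k) (\<theta> k) (d k) (v k) (w k) (t k) \<and>
          \<not> (d k = 0 \<and> violation c E I (x k) = 0) \<and>
          qp_multiplier c E I (x k) (g k) (B k) (\<theta> k) (d k) (v k) (w k) (t k) (lam (Suc k)) \<and>
          \<theta> (Suc k) = max (\<theta> k) (max_norm (E \<union> I) (lam (Suc k)) + \<gamma>) \<and>
          (\<exists>j. step k = \<tau> ^ j \<and>
               sufficient_decrease f c E I \<eta> (x k) (\<theta> k) (d k) (B k) (\<tau> ^ j) \<and>
               (\<forall>j'<j. \<not> sufficient_decrease f c E I \<eta> (x k) (\<theta> k) (d k) (B k) (\<tau> ^ j'))) \<and>
          x (Suc k) = x k + step k *\<^sub>R d k)"

section \<open>Standing assumptions\<close>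

definition assumption_A1 ::
    "'t itself \<Rightarrow> (real^'n \<Rightarrow> ereal) \<Rightarrow> (real^'n) set \<Rightarrow> real \<Rightarrow> bool" where
  "assumption_A1 ty f D \<rho> \<longleftrightarrow>
     (\<exists>U. open U \<and> D \<subseteq> U \<and> (\<forall>x\<in>U. \<bar>f x\<bar> \<noteq> \<infinity>) \<and>
          (\<exists>K. K-lipschitz_on U (\<lambda>x. real_of_ereal (f x))) \<and> upper_C2_on ty f U) \<and>
     0 < \<rho> \<and> convex_on D (\<lambda>x. - real_of_ereal (f x) + \<rho> / 2 * (norm x)\<^sup>2) \<and>
     (\<forall>x\<in>D. \<forall>z\<in>D. \<forall>g\<in>clarke_subdifferential f z.
        f x - f z - ereal (inner g (x - z)) \<le> ereal (\<rho> / 2 * (norm (x - z))\<^sup>2))"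

definition assumption_A2 ::
    "('i \<Rightarrow> real^'n \<Rightarrow> real) \<Rightarrow> 'i set \<Rightarrow> real \<Rightarrow> bool" where
  "assumption_A2 c S H \<longleftrightarrow> 0 \<le> H \<and>
     (\<forall>i\<in>S. (\<forall>x. c i differentiable (at x)) \<and> continuous_on UNIV (grad (c i)) \<and>
            (\<exists>K. K-lipschitz_on UNIV (grad (c i))) \<and>
            (\<forall>x x'. \<bar>c i x' - c i x - inner (grad (c i) x) (x' - x)\<bar> \<le> H / 2 * (norm (x - x'))\<^sup>2))"

definition assumption_A3 ::
    "(real^'n) set \<Rightarrow> (real^'n) set \<Rightarrow> (nat \<Rightarrow> real^'n) \<Rightarrow> (nat \<Rightarrow> real^'n) \<Rightarrow>
     (nat \<Rightarrow> real^'n^'n) \<Rightarrow> real \<Rightarrow> bool" where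
  "assumption_A3 \<Omega> D x d B b \<longleftrightarrow>
     compact D \<and> convex D \<and> \<Omega> \<subseteq> D \<and> (\<forall>k. x k \<in> D \<and> x k + d k \<in> D) \<and>
     (\<forall>k. transpose (B k) = B k) \<and> bounded (range B) \<and>
     0 < b \<and> (\<forall>k u. inner u (B k *v u) \<ge> b * (norm u)\<^sup>2)"

section \<open>The potential function\<close>

definition F_fun :: "(real^'n \<Rightarrow> ereal) \<Rightarrow> (real^'n) set \<Rightarrow> real \<Rightarrow> real^'n \<Rightarrow> ereal" where
  "F_fun f D \<sigma> x = (if x \<in> D then - f x + ereal (1/2 * \<sigma> * (norm x)\<^sup>2) else \<infinity>)"

definition C_bar ::
    "('i \<Rightarrow> real^'n \<Rightarrow> real) \<Rightarrow> 'i set \<Rightarrow> 'i set \<Rightarrow> ((real^'n) \<times> (real^'n)) set" where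
  "C_bar c E I = {(x, w). (\<forall>i\<in>E. c_lin c i x w = 0) \<and> (\<forall>i\<in>I. 0 \<le> c_lin c i x w)}"

definition potential ::
    "(real^'n \<Rightarrow> ereal) \<Rightarrow> ('i \<Rightarrow> real^'n \<Rightarrow> real) \<Rightarrow> 'i set \<Rightarrow> 'i set \<Rightarrow> (real^'n) set \<Rightarrow>
     real \<Rightarrow> real \<Rightarrow> (real^'n) \<times> (real^'n) \<times> (real^'n) \<Rightarrow> ereal" where
  "potential f c E I D \<sigma> l = (\<lambda>(x, y, w).
     ereal (- inner y x) + conjugate (F_fun f D \<sigma>) y + ereal (1/2 * \<sigma> * (norm x)\<^sup>2)
       + ereal (1/2 * l * (norm (x - w))\<^sup>2) + (if (x, w) \<in> C_bar c E I then 0 else \<infinity>))"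

end

theory Submission
  imports Defs
begin

text \<open>For affine constraints the multiplier conditions give
  \<open>g\<^sub>k \<bullet> d\<^sub>k + d\<^sub>k \<bullet> B\<^sub>k d\<^sub>k \<le> \<theta>\<^sub>k (v(x\<^sub>k) - v(x\<^sub>k + d\<^sub>k))\<close>, and with \<open>b \<ge> \<rho>\<close> the full step is accepted
  at every iteration. MFCQ at the limits of \<open>x\<^sub>k\<^sub>+\<^sub>1\<close>, where the inequalities with a positive multiplier
  are active, bounds the multipliers. The penalties therefore converge, they eventually exceed the
  multipliers strictly, the slacks vanish and the iterates are feasible.

  From then on, at \<open>z\<^sub>k = (x\<^sub>k\<^sub>+\<^sub>1, \<sigma> x\<^sub>k - g\<^sub>k, x\<^sub>k)\<close> the potential \<open>L\<close> satisfies
  \<open>f(x\<^sub>k\<^sub>+\<^sub>1) + l/2 |d\<^sub>k|\<^sup>2 \<le> L(z\<^sub>k) \<le> f(x\<^sub>k)\<close> and has a subgradient of norm \<open>O(|d\<^sub>k|)\<close>. Since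
  \<open>\<alpha> \<le> 1/2\<close>, the Kurdyka-Lojasiewicz inequality at the limits of \<open>z\<^sub>k\<close> yields
  \<open>L(z\<^sub>k) - \<zeta> = O(|d\<^sub>k|\<^sup>2)\<close> with \<open>\<zeta> = lim f(x\<^sub>k)\<close>. So \<open>f(x\<^sub>k\<^sub>+\<^sub>1) - \<zeta>\<close> is at most a multiple of
  \<open>f(x\<^sub>k) - f(x\<^sub>k\<^sub>+\<^sub>1)\<close>: the values, and with them the steps, decrease geometrically.\<close>

section \<open>Subsequences, gradients and subdifferentials\<close>

text \<open>Each \<open>P n\<close> holds beyond every bound, so the indices can be chosen one after
  another, with a new predicate at each. With \<open>P n\<close> the failure of an estimate with
  constant \<open>n\<close>, the absence of any constant yields one sequence that violates all of
  them.\<close>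

lemma infinitely_often_subsequence:
  assumes "\<And>n. \<not> (\<forall>\<^sub>F k in sequentially. \<not> P n k)"
  shows "\<exists>r::nat \<Rightarrow> nat. strict_mono r \<and> (\<forall>n. P n (r n))"
proof -
  have ex: "\<exists>k\<ge>N. P n k" for n N
    using assms[of n] by (auto simp: eventually_sequentially)
  then have "\<exists>k>N. P n k" for n N
    by (metis Suc_le_eq)
  then have "\<exists>r. \<forall>n. P n (r n) \<and> r n < r (Suc n)"
    using ex by (intro dependent_nat_choice) blast+
  then obtain r where "\<And>n. P n (r n) \<and> r n < r (Suc n)" by blast
  then show ?thesis
    by (intro exI[of _ r]) (simp add: strict_mono_Suc_iff)
qed

text \<open>Bolzano-Weierstrass for finitely many coordinates. The index type is arbitrary, so
  evaluations at \<open>i\<close> serve as the coordinates.\<close>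

lemma finite_family_convergent_subsequence:
  fixes \<mu> :: "nat \<Rightarrow> 'i \<Rightarrow> real"
  assumes "finite S" and bound: "\<And>n i. i \<in> S \<Longrightarrow> \<bar>\<mu> n i\<bar> \<le> M"
  obtains r l where "strict_mono r" "\<And>i. i \<in> S \<Longrightarrow> (\<lambda>n. \<mu> (r n) i) \<longlonglongrightarrow> l i"
proof -
  have "bounded ((\<lambda>x. x i) ` range \<mu>)" if "i \<in> S" for i
    using bound[OF that] by (auto simp: bounded_iff)
  then have "\<exists>l r. strict_mono r \<and>
      (\<forall>e>0. \<forall>\<^sub>F n in sequentially. \<forall>i\<in>S. dist (\<mu> (r n) i) (l i) < e)"
    using compact_lemma_general[OF \<open>finite S\<close>, of "\<lambda>x i. x i" \<mu> "\<lambda>x. x"] by blast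
  then obtain l r where r: "strict_mono r"
    and l: "\<And>e. e > 0 \<Longrightarrow> \<forall>\<^sub>F n in sequentially. \<forall>i\<in>S. dist (\<mu> (r n) i) (l i) < e"
    by blast
  have "(\<lambda>n. \<mu> (r n) i) \<longlonglongrightarrow> l i" if "i \<in> S" for i
    unfolding tendsto_iff using that by (auto intro: eventually_mono[OF l])
  then show thesis using that r by blast
qed

lemma grad_affine:
  assumes "\<And>x. h x = inner a x + \<beta>"
  shows "grad h x = a"
  unfolding grad_def
proof (rule the_equality)
  have h: "h = (\<lambda>x. inner a x + \<beta>)" using assms by blast
  show *: "GDERIV h x :> a"
    unfolding gderiv_def h by (auto intro!: derivative_eq_intros simp: inner_commute)
  fix g assume "GDERIV h x :> g"
  then have "(\<lambda>h. inner h g) = (\<lambda>h. inner h a)"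
    using * has_derivative_unique unfolding gderiv_def by blast
  then show "g = a"
    by (metis vector_eq_ldot)
qed

text \<open>The direction \<open>g\<close> itself is tested: the Lipschitz bound caps the
  generalized derivative there by \<open>K * norm g\<close>, and membership makes it at least the
  square of \<open>norm g\<close>.\<close>

lemma clarke_subdifferential_bounded:
  fixes f :: "'a::euclidean_space \<Rightarrow> ereal"
  assumes "open U" "x \<in> U" and fin: "\<And>z. z \<in> U \<Longrightarrow> \<bar>f z\<bar> \<noteq> \<infinity>"
    and lip: "K-lipschitz_on U (\<lambda>z. real_of_ereal (f z))"
    and g: "g \<in> clarke_subdifferential f x"
  shows "norm g \<le> K"
proof -
  have "clarke_derivative f x g \<le> ereal (K * norm g)"
    unfolding clarke_derivative_def
  proof (rule Limsup_bounded)
    have lim: "((\<lambda>(y, s). y + s *\<^sub>R g) \<longlongrightarrow> x + 0 *\<^sub>R g) (nhds x \<times>\<^sub>F at_right (0::real))"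
      unfolding case_prod_unfold
      by (intro tendsto_intros filterlim_compose[OF _ filterlim_fst]
            filterlim_compose[OF _ filterlim_snd])
        (auto intro: filterlim_mono[OF filterlim_ident] simp: at_within_def)
    have 1: "\<forall>\<^sub>F p in nhds x \<times>\<^sub>F at_right (0::real). fst p + snd p *\<^sub>R g \<in> U"
      using topological_tendstoD[OF lim \<open>open U\<close>] \<open>x \<in> U\<close> by (simp add: case_prod_unfold)
    have 2: "\<forall>\<^sub>F p in nhds x \<times>\<^sub>F at_right (0::real). fst p \<in> U \<and> snd p > 0"
      using assms(1,2) by (intro eventually_prodI) 
        (auto simp: eventually_nhds eventually_at_right_less)
    show "\<forall>\<^sub>F p in nhds x \<times>\<^sub>F at_right 0.
        (case p of (y, s) \<Rightarrow> (f (y + s *\<^sub>R g) - f y) / ereal s) \<le> ereal (K * norm g)"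
      using 1 2
    proof eventually_elim
      case (elim p)
      obtain y s where p: "p = (y, s)" by force
      have "y \<in> U" "y + s *\<^sub>R g \<in> U" and s: "s > 0" using elim p by auto
      then obtain u v where uv: "f y = ereal u" "f (y + s *\<^sub>R g) = ereal v"
        using fin by (meson ereal_cases abs_neq_infinity_cases)
      have "dist v u \<le> K * dist (y + s *\<^sub>R g) y"
        using lipschitz_onD[OF lip \<open>y + s *\<^sub>R g \<in> U\<close> \<open>y \<in> U\<close>] uv by simp
      then have "v - u \<le> K * norm g * s"
        using s by (simp add: dist_norm mult_ac)
      then show ?case
        using s uv p by (simp add: divide_simps)
    qed
  qed
  moreover have "ereal (inner g g) \<le> clarke_derivative f x g"
    using g by (simp add: clarke_subdifferential_def)
  ultimately have "norm g * norm g \<le> K * norm g"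
    by (metis ereal_less_eq(3) order_trans power2_norm_eq_inner power2_eq_square)
  moreover have "K \<ge> 0" using lip by (rule lipschitz_on_nonneg)
  ultimately show ?thesis
    by (metis mult_right_le_imp_le norm_ge_zero not_le_imp_less order_le_less)
qed

text \<open>The quadratic error, divided by \<open>norm (y - x)\<close>, tends to 0. Allowing it
  lets an indefinite cross term of the potential be absorbed.\<close>

lemma regular_subdifferentialI:
  fixes h :: "'a::euclidean_space \<Rightarrow> ereal"
  assumes hx: "h x = ereal a"
    and low: "\<And>y. ereal (a + inner v (y - x) - (norm (y - x))\<^sup>2) \<le> h y"
  shows "v \<in> regular_subdifferential h x"
proof -
  have lim: "((\<lambda>y. ereal (- norm (y - x))) \<longlongrightarrow> ereal (- norm (x - x))) (at x)"
    by (intro tendsto_intros)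
  have "0 = Liminf (at x) (\<lambda>y. ereal (- norm (y - x)))"
    using lim_imp_Liminf[OF _ lim] by (simp add: zero_ereal_def)
  also have "\<dots> \<le> Liminf (at x) (\<lambda>y. (h y - h x - ereal (inner v (y - x))) / ereal (norm (y - x)))"
  proof (rule Liminf_mono)
    show "\<forall>\<^sub>F y in at x. ereal (- norm (y - x))
        \<le> (h y - h x - ereal (inner v (y - x))) / ereal (norm (y - x))"
      unfolding eventually_at_filter
    proof (intro always_eventually allI impI)
      fix y assume "y \<noteq> x"
      then have pos: "norm (y - x) > 0" by simp
      show "ereal (- norm (y - x)) \<le> (h y - h x - ereal (inner v (y - x))) / ereal (norm (y - x))"
      proof (cases "h y")
        case (real b)
        then have "a + inner v (y - x) - (norm (y - x))\<^sup>2 \<le> b" using low[of y] by simp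
        then have "- norm (y - x) * norm (y - x) \<le> b - a - inner v (y - x)"
          by (simp add: power2_eq_square)
        then show ?thesis using pos real hx by (simp add: le_divide_eq)
      next
        case MInf
        then show ?thesis using low[of y] by simp
      qed (use pos hx in \<open>simp add: divide_ereal_def\<close>)
    qed
  qed
  finally show ?thesis by (simp add: regular_subdifferential_def hx)
qed

lemma regular_subdifferential_subset_limiting:
  "regular_subdifferential h x \<subseteq> limiting_subdifferential h x"
proof
  fix v assume v: "v \<in> regular_subdifferential h x"
  then have "\<bar>h x\<bar> \<noteq> \<infinity>" by (simp add: regular_subdifferential_def)
  moreover have "\<exists>xs vs. xs \<longlonglongrightarrow> x \<and> (\<lambda>n. h (xs n)) \<longlonglongrightarrow> h x \<and>
      (\<forall>n. vs n \<in> regular_subdifferential h (xs n)) \<and> vs \<longlonglongrightarrow> v"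
    by (rule exI[of _ "\<lambda>_. x"], rule exI[of _ "\<lambda>_. v"]) (use v in simp)
  ultimately show "v \<in> limiting_subdifferential h x"
    by (simp add: limiting_subdifferential_def)
qed

section \<open>Multipliers and steps for affine constraints\<close>

text \<open>Pairing the relation with the MFCQ direction \<open>w\<close> kills the equality terms
  and leaves nonnegative terms with sum 0, so the inequality multipliers vanish. Linear independence
  then handles the equality multipliers.\<close>

lemma mfcq_multipliers_zero:
  assumes fin: "finite E" "finite I" "E \<inter> I = {}" and mfcq: "mfcq c E I z"
    and nonneg: "\<And>i. i \<in> I \<Longrightarrow> 0 \<le> \<mu> i"
    and active: "\<And>i. i \<in> I \<Longrightarrow> 0 < \<mu> i \<Longrightarrow> c i z = 0"
    and zero: "(\<Sum>i\<in>E \<union> I. \<mu> i *\<^sub>R grad (c i) z) = 0"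
    and i: "i \<in> E \<union> I"
  shows "\<mu> i = 0"
proof -
  obtain w where wI: "\<And>i. i \<in> I \<Longrightarrow> c i z = 0 \<Longrightarrow> 0 < inner (grad (c i) z) w"
    and wE: "\<And>i. i \<in> E \<Longrightarrow> inner (grad (c i) z) w = 0"
    using mfcq by (auto simp: mfcq_def)
  have split: "(\<Sum>i\<in>E \<union> I. \<mu> i *\<^sub>R grad (c i) z)
      = (\<Sum>i\<in>E. \<mu> i *\<^sub>R grad (c i) z) + (\<Sum>i\<in>I. \<mu> i *\<^sub>R grad (c i) z)"
    using fin by (simp add: sum.union_disjoint)
  have "0 = inner (\<Sum>i\<in>E \<union> I. \<mu> i *\<^sub>R grad (c i) z) w" using zero by simp
  also have "\<dots> = (\<Sum>i\<in>I. \<mu> i * inner (grad (c i) z) w)"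
    unfolding split by (simp add: inner_add_left inner_sum_left wE)
  finally have sum0: "(\<Sum>i\<in>I. \<mu> i * inner (grad (c i) z) w) = 0" by simp
  have ge: "\<mu> i * inner (grad (c i) z) w \<ge> 0" if "i \<in> I" for i
    using nonneg[OF that] active[OF that] wI[OF that] by (cases "\<mu> i = 0") auto
  have I0: "\<mu> i = 0" if "i \<in> I" for i
  proof -
    have "\<mu> i * inner (grad (c i) z) w = 0"
      using sum_nonneg_eq_0_iff[OF fin(2), of "\<lambda>i. \<mu> i * inner (grad (c i) z) w"] ge sum0 that
      by blast
    then show ?thesis
      using nonneg[OF that] active[OF that] wI[OF that] by (cases "\<mu> i = 0") auto
  qed
  then have E: "(\<Sum>i\<in>E. \<mu> i *\<^sub>R grad (c i) z) = 0"
    using zero unfolding split by simp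
  have inj: "inj_on (\<lambda>i. grad (c i) z) E" and ind: "independent ((\<lambda>i. grad (c i) z) ` E)"
    using mfcq by (auto simp: mfcq_def)
  let ?a = "\<lambda>i. grad (c i) z"
  \<comment> \<open>\<open>independent\<close> speaks of sets of vectors, so the indexed sum is
    rewritten over the image, with coefficients read back through the inverse of the
    injection.\<close>
  have "(\<Sum>v\<in>?a ` E. \<mu> (the_inv_into E ?a v) *\<^sub>R v) = 0"
    using E by (simp add: sum.reindex[OF inj] the_inv_into_f_f[OF inj])
  then have "\<mu> (the_inv_into E ?a (?a i)) = 0" if "i \<in> E" for i
    using ind fin(1) that unfolding independent_explicit_module dependent_finite
    by (meson finite_imageI imageI order_refl)
  then show ?thesis using I0 i by (auto simp: the_inv_into_f_f[OF inj])
qed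

text \<open>Unbounded multipliers, normalised to sum norm 1, would converge along a subsequence to
  nonzero multipliers for the gradients at a limit of \<open>y\<close>, contradicting MFCQ there.\<close>

lemma mfcq_multipliers_bounded:
  fixes c :: "'i \<Rightarrow> real^'n \<Rightarrow> real"
  assumes fin: "finite E" "finite I" "E \<inter> I = {}"
    and aff: "\<And>i z. i \<in> E \<union> I \<Longrightarrow> c i z = inner (a i) z + \<beta> i"
    and D: "compact D" "\<And>k. y k \<in> D"
    and MFCQ: "\<And>z. accumulation_point y z \<Longrightarrow> mfcq c E I z"
    and stat: "\<And>k. (\<Sum>i\<in>E \<union> I. lam k i *\<^sub>R a i) = u k" and u: "\<And>k. norm (u k) \<le> M"
    and nonneg: "\<And>k i. i \<in> I \<Longrightarrow> 0 \<le> lam k i"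
    and compl: "\<And>k i. i \<in> I \<Longrightarrow> 0 < lam k i \<Longrightarrow> c i (y k) \<le> 0"
  obtains R where "\<forall>\<^sub>F k in sequentially. \<forall>i\<in>E \<union> I. \<bar>lam k i\<bar> \<le> R"
proof (rule ccontr)
  assume "\<not> thesis"
  then have unb: "\<not> (\<forall>\<^sub>F k in sequentially. \<forall>i\<in>E \<union> I. \<bar>lam k i\<bar> \<le> R)" for R
    using that by blast
  define N where "N k = (\<Sum>i\<in>E \<union> I. \<bar>lam k i\<bar>)" for k
  have le_N: "\<bar>lam k i\<bar> \<le> N k" if "i \<in> E \<union> I" for k i
    unfolding N_def using fin that by (intro member_le_sum) auto
  have "\<not> (\<forall>\<^sub>F k in sequentially. \<not> real n < N k)" for n
  proof
    assume "\<forall>\<^sub>F k in sequentially. \<not> real n < N k"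
    then have "\<forall>\<^sub>F k in sequentially. \<forall>i\<in>E \<union> I. \<bar>lam k i\<bar> \<le> real n"
      by (rule eventually_mono) (meson le_N not_less order_trans)
    then show False using unb by blast
  qed
  then have "\<exists>r. strict_mono r \<and> (\<forall>n. real n < N (r n))"
    by (rule infinitely_often_subsequence)
  then obtain r where r: "strict_mono r" "\<And>n. real n < N (r n)"
    by blast
  have "\<bar>lam (r n) i / N (r n)\<bar> \<le> 1" if "i \<in> E \<union> I" for n i
    using le_N[OF that, of "r n"] r(2)[of n] by (simp add: divide_simps)
  then obtain s l where s: "strict_mono s"
    and l: "\<And>i. i \<in> E \<union> I \<Longrightarrow> (\<lambda>n. lam (r (s n)) i / N (r (s n))) \<longlonglongrightarrow> l i"
    using fin
    by - (rule finite_family_convergent_subsequence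
        [of "E \<union> I" "\<lambda>n i. lam (r n) i / N (r n)" 1], auto)
  obtain z p where p: "strict_mono p" and z: "(\<lambda>n. y (r (s (p n)))) \<longlonglongrightarrow> z"
    using D(1)[unfolded compact_def, rule_format, of "\<lambda>n. y (r (s n))"] D(2)
    unfolding o_def by blast
  define q where "q n = r (s (p n))" for n
  have q: "strict_mono q"
    using r(1) s p by (auto simp: q_def strict_mono_def)
  have yq: "(\<lambda>n. y (q n)) \<longlonglongrightarrow> z" using z by (simp add: q_def)
  have "accumulation_point y z"
    unfolding accumulation_point_def using q yq by (auto simp: o_def)
  then have mf: "mfcq c E I z" by (rule MFCQ)
  have \<mu>: "(\<lambda>n. lam (q n) i / N (q n)) \<longlonglongrightarrow> l i" if "i \<in> E \<union> I" for i
    using LIMSEQ_subseq_LIMSEQ[OF l[OF that] p] by (simp add: q_def o_def)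
  \<comment> \<open>A strictly increasing map of indices lies above the identity, so the growth of
    \<open>N\<close> survives both further subsequences.\<close>
  have Nq: "real n < N (q n)" for n
    using r(2)[of "s (p n)"] seq_suble[OF s, of "p n"] seq_suble[OF p, of n]
    unfolding q_def by linarith
  have Npos: "0 < N (q n)" for n using Nq[of n] by linarith
  have "(\<lambda>n. \<Sum>i\<in>E \<union> I. \<bar>lam (q n) i / N (q n)\<bar>) \<longlonglongrightarrow> (\<Sum>i\<in>E \<union> I. \<bar>l i\<bar>)"
    by (intro tendsto_intros \<mu>)
  moreover have "(\<Sum>i\<in>E \<union> I. \<bar>lam (q n) i / N (q n)\<bar>) = 1" for n
    using Npos[of n] by (simp add: N_def abs_divide flip: sum_divide_distrib)
  ultimately have sum1: "(\<Sum>i\<in>E \<union> I. \<bar>l i\<bar>) = 1"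
    by (simp add: LIMSEQ_const_iff)
  have "(\<lambda>n. \<Sum>i\<in>E \<union> I. (lam (q n) i / N (q n)) *\<^sub>R a i) \<longlonglongrightarrow> (\<Sum>i\<in>E \<union> I. l i *\<^sub>R a i)"
    by (intro tendsto_intros \<mu>)
  \<comment> \<open>The bounded right-hand sides \<open>u\<close> are divided by
    \<open>N (q n)\<close>, which exceeds \<open>n\<close>.\<close>
  moreover have "(\<lambda>n. \<Sum>i\<in>E \<union> I. (lam (q n) i / N (q n)) *\<^sub>R a i) \<longlonglongrightarrow> 0"
  proof (rule Lim_null_comparison)
    show "(\<lambda>n. M * inverse (real n)) \<longlonglongrightarrow> 0"
      by (intro tendsto_mult_right_zero lim_inverse_n)
    show "\<forall>\<^sub>F n in sequentially.
        norm (\<Sum>i\<in>E \<union> I. (lam (q n) i / N (q n)) *\<^sub>R a i) \<le> M * inverse (real n)"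
      using eventually_gt_at_top[of 0]
    proof eventually_elim
      case (elim n)
      have "(\<Sum>i\<in>E \<union> I. (lam (q n) i / N (q n)) *\<^sub>R a i) = inverse (N (q n)) *\<^sub>R u (q n)"
        by (simp add: scaleR_sum_right divide_inverse mult.commute flip: stat)
      then have "norm (\<Sum>i\<in>E \<union> I. (lam (q n) i / N (q n)) *\<^sub>R a i)
          = inverse (N (q n)) * norm (u (q n))"
        using Npos[of n] by simp
      also have "\<dots> \<le> inverse (real n) * M"
        using elim Nq[of n] u[of "q n"] by (intro mult_mono) (auto intro!: le_imp_inverse_le)
      finally show ?case by (simp add: mult.commute)
    qed
  qed
  ultimately have zero: "(\<Sum>i\<in>E \<union> I. l i *\<^sub>R a i) = 0"
    using LIMSEQ_unique by blast
  have gr: "grad (c i) z = a i" if "i \<in> E \<union> I" for i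
    by (rule grad_affine) (rule aff[OF that])
  have "l i = 0" if "i \<in> E \<union> I" for i
  proof (rule mfcq_multipliers_zero[OF fin mf])
    show "0 \<le> l i" if "i \<in> I" for i
    proof (rule LIMSEQ_le_const[OF \<mu>])
      show "\<exists>N'. \<forall>n\<ge>N'. 0 \<le> lam (q n) i / N (q n)"
        using nonneg[OF that] Npos by (simp add: less_imp_le)
    qed (use that in auto)
    \<comment> \<open>A positive limit means positive multipliers eventually, where complementarity
      gives \<open>c i (y (q n)) \<le> 0\<close>. The opposite inequality at \<open>z\<close> is the
      feasibility contained in \<open>mfcq\<close>.\<close>
    show "c i z = 0" if i: "i \<in> I" "0 < l i" for i
    proof -
      have "\<forall>\<^sub>F n in sequentially. 0 < lam (q n) i / N (q n)"
        using order_tendstoD(1)[OF \<mu>, of i 0] i by simp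
      then have "\<forall>\<^sub>F n in sequentially. c i (y (q n)) \<le> 0"
        by (rule eventually_mono) (meson compl i(1) Npos zero_less_divide_iff order.asym)
      moreover have "(\<lambda>n. c i (y (q n))) \<longlonglongrightarrow> c i z"
        using i aff by (auto intro!: tendsto_intros yq)
      ultimately have "c i z \<le> 0"
        by (rule tendsto_upperbound[OF _ _ sequentially_bot, rotated])
      moreover have "c i z \<ge> 0" using mf i by (simp add: mfcq_def feasible_set_def)
      ultimately show ?thesis by simp
    qed
    show "(\<Sum>i\<in>E \<union> I. l i *\<^sub>R grad (c i) z) = 0"
      using zero gr by simp
  qed (use that in auto)
  then show False using sum1 by simp
qed

text \<open>Stationarity paired with \<open>d\<close> leaves a sum of multipliers times changes of
  the constraints, the linearizations being exact. Each term is at most \<open>\<theta>\<close>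
  times the drop of the violation: the multipliers lie between \<open>-\<theta>\<close> and
  \<open>\<theta>\<close> and attain the matching bound where a slack is positive.\<close>

lemma affine_qp_step:
  fixes c :: "'i \<Rightarrow> real^'n \<Rightarrow> real"
  assumes fin: "finite E" "finite I" "E \<inter> I = {}"
    and aff: "\<And>i z. i \<in> E \<union> I \<Longrightarrow> c i z = inner (a i) z + \<beta> i"
    and feas: "qp_feasible c E I x d v w t" and mult: "qp_multiplier c E I x g B \<theta> d v w t lam"
    and "0 \<le> \<theta>"
  shows "inner g d + inner d (B *v d) \<le> \<theta> * (violation c E I x - violation c E I (x + d))"
proof -
  have gr: "grad (c i) x = a i" if "i \<in> E \<union> I" for i
    by (rule grad_affine) (rule aff[OF that])
  have step: "c i x + inner (grad (c i) x) d = c i (x + d)"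
    "inner (grad (c i) x) d = c i (x + d) - c i x" if "i \<in> E \<union> I" for i
    using aff[OF that] gr[OF that] by (auto simp: inner_add_right)
  obtain p q r
    where E_mult: "\<And>i. i \<in> E \<Longrightarrow> 0 \<le> p i \<and> 0 \<le> q i \<and> \<theta> + lam i = p i \<and> \<theta> - lam i = q i \<and>
        p i * v i = 0 \<and> q i * w i = 0"
      and I_mult: "\<And>i. i \<in> I \<Longrightarrow> 0 \<le> lam i \<and>
        lam i * (c i x + inner (grad (c i) x) d + t i) = 0 \<and>
        0 \<le> r i \<and> \<theta> - lam i = r i \<and> r i * t i = 0"
    using mult unfolding qp_multiplier_def by blast
  have Ei: "lam i * inner (grad (c i) x) d \<le> \<theta> * \<bar>c i x\<bar> - \<theta> * \<bar>c i (x + d)\<bar>" if i: "i \<in> E" for i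
  proof -
    have cd: "c i (x + d) = v i - w i" and vw: "0 \<le> v i" "0 \<le> w i"
      using feas i step(1)[of i] by (auto simp: qp_feasible_def)
    have m: "\<bar>lam i\<bar> \<le> \<theta>" "(\<theta> + lam i) * v i = 0" "(\<theta> - lam i) * w i = 0"
      using E_mult[OF i] by auto
    \<comment> \<open>The product is regrouped so that the two complementarity products, which
      vanish, split off.\<close>
    have "lam i * (v i - w i) = (\<theta> + lam i) * v i + (\<theta> - lam i) * w i - \<theta> * (v i + w i)"
      by (simp only: algebra_simps)
    then have "lam i * (v i - w i) = - \<theta> * (v i + w i)"
      using m(2,3) by simp
    moreover have "- (lam i * c i x) \<le> \<theta> * \<bar>c i x\<bar>"
      by (metis abs_ge_minus_self abs_ge_zero abs_mult m(1) mult_right_mono order_trans)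
    moreover have "\<theta> * \<bar>c i (x + d)\<bar> \<le> \<theta> * (v i + w i)"
      using vw \<open>0 \<le> \<theta>\<close> by (intro mult_left_mono) (auto simp: cd)
    moreover have "lam i * inner (grad (c i) x) d = lam i * (v i - w i) - lam i * c i x"
      using step(2)[of i] i cd by (simp add: right_diff_distrib)
    ultimately show ?thesis by linarith
  qed
  have Ii: "lam i * inner (grad (c i) x) d
      \<le> \<theta> * max 0 (- c i x) - \<theta> * max 0 (- c i (x + d))" if i: "i \<in> I" for i
  proof -
    have t: "- t i \<le> c i (x + d)" "0 \<le> t i"
      using feas i step(1)[of i] by (auto simp: qp_feasible_def)
    have m: "0 \<le> lam i" "lam i * (c i (x + d) + t i) = 0" "lam i \<le> \<theta>" "(\<theta> - lam i) * t i = 0"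
      using I_mult[OF i] step(1)[of i] i by auto
    have "lam i * c i (x + d) = lam i * (c i (x + d) + t i) + (\<theta> - lam i) * t i - \<theta> * t i"
      by (simp only: algebra_simps)
    then have "lam i * c i (x + d) = - \<theta> * t i"
      using m(2,4) by simp
    moreover have "lam i * (- c i x) \<le> \<theta> * max 0 (- c i x)"
      using m by (intro order_trans[OF mult_left_mono mult_right_mono]) auto
    moreover have "\<theta> * max 0 (- c i (x + d)) \<le> \<theta> * t i"
      using t \<open>0 \<le> \<theta>\<close> by (intro mult_left_mono) auto
    moreover have "lam i * inner (grad (c i) x) d = lam i * c i (x + d) + lam i * (- c i x)"
      using step(2)[of i] i by (simp add: right_diff_distrib)
    ultimately show ?thesis by linarith
  qed
  have eq: "g + B *v d = (\<Sum>i\<in>E \<union> I. lam i *\<^sub>R grad (c i) x)"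
    using mult by (simp add: qp_multiplier_def)
  have "inner g d + inner d (B *v d) = inner (g + B *v d) d"
    by (simp add: inner_add_left inner_commute[of d])
  also have "\<dots> = (\<Sum>i\<in>E. lam i * inner (grad (c i) x) d) + (\<Sum>i\<in>I. lam i * inner (grad (c i) x) d)"
    unfolding eq using fin by (simp add: inner_sum_left inner_add_left sum.union_disjoint)
  also have "\<dots> \<le> (\<Sum>i\<in>E. \<theta> * \<bar>c i x\<bar> - \<theta> * \<bar>c i (x + d)\<bar>)
      + (\<Sum>i\<in>I. \<theta> * max 0 (- c i x) - \<theta> * max 0 (- c i (x + d)))"
    by (intro add_mono sum_mono Ei Ii)
  also have "\<dots> = \<theta> * (violation c E I x - violation c E I (x + d))"
    by (simp add: violation_def sum_subtractf sum_distrib_left algebra_simps)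
  finally show ?thesis .
qed

lemma norm_matrix_vector_mult_le:
  fixes A :: "real^'n^'m"
  shows "norm (A *v z) \<le> real CARD('m) * norm A * norm z"
proof -
  have "\<bar>(A *v z) $ i\<bar> \<le> norm A * norm z" for i
  proof -
    have "\<bar>(A *v z) $ i\<bar> \<le> norm (A $ i) * norm z"
      by (simp add: matrix_vector_mul_component Cauchy_Schwarz_ineq2)
    also have "\<dots> \<le> norm A * norm z"
      by (intro mult_right_mono Finite_Cartesian_Product.norm_nth_le) auto
    finally show ?thesis .
  qed
  then have "(\<Sum>i\<in>UNIV. \<bar>(A *v z) $ i\<bar>) \<le> real CARD('m) * (norm A * norm z)"
    by (intro sum_bounded_above)
  then show ?thesis
    using norm_le_l1_cart[of "A *v z"] by (simp add: mult.assoc)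
qed

lemma abs_le_max_norm: "finite S \<Longrightarrow> i \<in> S \<Longrightarrow> \<bar>lam i\<bar> \<le> max_norm S lam"
  unfolding max_norm_def by (intro Max_ge) auto

lemma max_norm_le: "finite S \<Longrightarrow> 0 \<le> R \<Longrightarrow> (\<And>i. i \<in> S \<Longrightarrow> \<bar>lam i\<bar> \<le> R) \<Longrightarrow> max_norm S lam \<le> R"
  unfolding max_norm_def by (subst Max_le_iff) auto

text \<open>Complementarity in iteration \<open>k\<close> concerns \<open>x (Suc k)\<close>, so MFCQ
  is required along the shifted sequence.\<close>

lemma accumulation_point_Suc:
  assumes "accumulation_point (\<lambda>k. x (Suc k)) z"
  shows "accumulation_point x z"
proof -
  obtain r where r: "strict_mono r" "(\<lambda>n. x (Suc (r n))) \<longlonglongrightarrow> z"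
    using assms by (auto simp: accumulation_point_def o_def)
  then show ?thesis
    unfolding accumulation_point_def
    by (intro exI[of _ "\<lambda>n. Suc (r n)"]) (simp add: strict_mono_def o_def)
qed

text \<open>The penalties may increase infinitely often, but they converge, so an increment is eventually
  smaller than \<open>\<gamma>\<close>.\<close>

lemma penalty_exceeds_multipliers:
  fixes \<theta> \<mu> :: "nat \<Rightarrow> real"
  assumes step: "\<And>k. \<theta> (Suc k) = max (\<theta> k) (\<mu> k + \<gamma>)"
    and bound: "\<forall>\<^sub>F k in sequentially. \<mu> k \<le> R" and "0 < \<gamma>"
  shows "\<forall>\<^sub>F k in sequentially. \<mu> k < \<theta> k"
proof -
  have inc: "incseq \<theta>" by (simp add: incseq_SucI step)
  obtain N where N: "\<And>k. k \<ge> N \<Longrightarrow> \<mu> k \<le> R"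
    using bound by (auto simp: eventually_sequentially)
  have "\<theta> k \<le> max (\<theta> N) (R + \<gamma>)" if "k \<ge> N" for k
    using that
  proof (induction rule: dec_induct)
    case (step k)
    then show ?case using N[of k] assms(1)[of k] by simp
  qed simp
  moreover have "\<theta> k \<le> \<theta> N" if "k \<le> N" for k using inc that by (simp add: incseqD)
  ultimately have "\<theta> k \<le> max (\<theta> N) (R + \<gamma>)" for k
    by (meson le_max_iff_disj nle_le)
  then obtain T where T: "\<theta> \<longlonglongrightarrow> T"
    using incseq_convergent[OF inc] by blast
  have "(\<lambda>k. \<theta> (Suc k) - \<theta> k) \<longlonglongrightarrow> T - T"
    by (intro tendsto_intros T LIMSEQ_Suc[OF T])
  then have "\<forall>\<^sub>F k in sequentially. \<theta> (Suc k) - \<theta> k < \<gamma>"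
    using \<open>0 < \<gamma>\<close> by (intro order_tendstoD(2)) auto
  then show ?thesis
  proof eventually_elim
    case (elim k)
    then show ?case using step[of k] by linarith
  qed
qed

section \<open>The potential function along the iterates\<close>

text \<open>The Fenchel-Young inequality: a single term of the supremum.\<close>

lemma conjugate_F_fun_ge:
  assumes "p \<in> D" "f p = ereal u"
  shows "ereal (inner y p + u - \<sigma> / 2 * (norm p)\<^sup>2) \<le> conjugate (F_fun f D \<sigma>) y"
  unfolding conjugate_def
  by (rule SUP_upper2[of p]) (use assms in \<open>auto simp: F_fun_def\<close>)

text \<open>After expansion of the squares, \<open>supp\<close> says that
  \<open>\<sigma> *\<^sub>R q - g\<close> is a subgradient of \<open>F_fun f D \<sigma>\<close> at
  \<open>q\<close>. This is the equality case of Fenchel-Young.\<close>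

lemma conjugate_F_fun_eq:
  assumes q: "q \<in> D" and f: "\<forall>z\<in>D. f z = ereal (fr z)"
    and supp: "\<forall>z\<in>D. fr z \<le> fr q + inner g (z - q) + \<sigma> / 2 * (norm (z - q))\<^sup>2"
  shows "conjugate (F_fun f D \<sigma>) (\<sigma> *\<^sub>R q - g)
    = ereal (inner (\<sigma> *\<^sub>R q - g) q + fr q - \<sigma> / 2 * (norm q)\<^sup>2)"
proof (rule antisym)
  show "conjugate (F_fun f D \<sigma>) (\<sigma> *\<^sub>R q - g)
      \<le> ereal (inner (\<sigma> *\<^sub>R q - g) q + fr q - \<sigma> / 2 * (norm q)\<^sup>2)"
    unfolding conjugate_def
  proof (rule SUP_least)
    fix z
    show "ereal (inner (\<sigma> *\<^sub>R q - g) z) - F_fun f D \<sigma> z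
        \<le> ereal (inner (\<sigma> *\<^sub>R q - g) q + fr q - \<sigma> / 2 * (norm q)\<^sup>2)"
    proof (cases "z \<in> D")
      case True
      have "\<sigma> / 2 * (norm (z - q))\<^sup>2
          = \<sigma> / 2 * (norm z)\<^sup>2 - \<sigma> * inner q z + \<sigma> / 2 * (norm q)\<^sup>2"
        unfolding power2_norm_eq_inner
        by (simp add: inner_diff_left inner_diff_right inner_commute algebra_simps)
      moreover have "inner (\<sigma> *\<^sub>R q - g) z = \<sigma> * inner q z - inner g z"
        "inner (\<sigma> *\<^sub>R q - g) q = \<sigma> * (norm q)\<^sup>2 - inner g q"
        "inner g (z - q) = inner g z - inner g q"
        by (simp_all add: inner_diff_left inner_diff_right power2_norm_eq_inner)
      ultimately have "inner (\<sigma> *\<^sub>R q - g) z + fr z - \<sigma> / 2 * (norm z)\<^sup>2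
          \<le> inner (\<sigma> *\<^sub>R q - g) q + fr q - \<sigma> / 2 * (norm q)\<^sup>2"
        using supp[rule_format, OF True] by linarith
      then show ?thesis
        using f True by (simp add: F_fun_def)
    qed (simp add: F_fun_def)
  qed
qed (rule conjugate_F_fun_ge[of q D f "fr q", OF q f[rule_format, OF q]])

text \<open>The linearization of an affine function at any point is the function itself, so the
  indicator term depends on \<open>p\<close> alone.\<close>

lemma potential_affine:
  assumes aff: "\<forall>i\<in>E \<union> I. \<forall>z. c i z = inner (a i) z + \<beta> i"
  shows "potential f c E I D \<sigma> l (p, y, q) =
    ereal (- inner y p) + conjugate (F_fun f D \<sigma>) y + ereal (1/2 * \<sigma> * (norm p)\<^sup>2)
      + ereal (1/2 * l * (norm (p - q))\<^sup>2) + (if p \<in> feasible_set c E I then 0 else \<infinity>)"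
proof -
  have "c_lin c i p q = c i p" if "i \<in> E \<union> I" for i
  proof -
    have "grad (c i) q = a i" by (rule grad_affine) (use aff that in blast)
    then show ?thesis unfolding c_lin_def aff[rule_format, OF that] by (simp add: inner_diff_right)
  qed
  then have "(p, q) \<in> C_bar c E I \<longleftrightarrow> p \<in> feasible_set c E I"
    by (auto simp: C_bar_def feasible_set_def)
  then show ?thesis by (simp add: potential_def)
qed

lemma potential_ge:
  assumes aff: "\<forall>i\<in>E \<union> I. \<forall>z. c i z = inner (a i) z + \<beta> i"
    and s: "s \<in> D" "f s = ereal u"
  shows "ereal (inner y (s - p) + u - \<sigma> / 2 * (norm s)\<^sup>2 + \<sigma> / 2 * (norm p)\<^sup>2
      + l / 2 * (norm (p - q))\<^sup>2) \<le> potential f c E I D \<sigma> l (p, y, q)"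
proof -
  have "ereal (inner y s + u - \<sigma> / 2 * (norm s)\<^sup>2) \<le> conjugate (F_fun f D \<sigma>) y"
    by (rule conjugate_F_fun_ge[of s D f u y \<sigma>, OF s])
  then show ?thesis
    unfolding potential_affine[OF aff]
    by (cases "conjugate (F_fun f D \<sigma>) y") (auto simp: inner_diff_right)
qed

text \<open>With the conjugate evaluated exactly, the terms in \<open>\<sigma>\<close> combine to a
  square. What remains is the quadratic upper model of \<open>fr\<close> at \<open>q\<close>, plus
  the proximal term in \<open>l\<close>.\<close>

lemma potential_eq:
  assumes aff: "\<forall>i\<in>E \<union> I. \<forall>z. c i z = inner (a i) z + \<beta> i"
    and q: "q \<in> D" and f: "\<forall>z\<in>D. f z = ereal (fr z)"
    and supp: "\<forall>z\<in>D. fr z \<le> fr q + inner g (z - q) + \<sigma> / 2 * (norm (z - q))\<^sup>2"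
    and p: "p \<in> feasible_set c E I"
  shows "potential f c E I D \<sigma> l (p, \<sigma> *\<^sub>R q - g, q)
    = ereal (fr q + inner g (p - q) + (\<sigma> + l) / 2 * (norm (p - q))\<^sup>2)"
proof -
  have "(norm (p - q))\<^sup>2 = (norm p)\<^sup>2 - 2 * inner q p + (norm q)\<^sup>2"
    unfolding power2_norm_eq_inner by (simp add: inner_diff_left inner_diff_right inner_commute)
  then have "\<sigma> / 2 * (norm (p - q))\<^sup>2
      = \<sigma> / 2 * ((norm p)\<^sup>2 - 2 * inner q p + (norm q)\<^sup>2)"
    by simp
  then have "\<sigma> / 2 * (norm (p - q))\<^sup>2
      = \<sigma> / 2 * (norm p)\<^sup>2 - \<sigma> * inner q p + \<sigma> / 2 * (norm q)\<^sup>2"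
    by (simp add: distrib_left right_diff_distrib)
  moreover have "inner q q = (norm q)\<^sup>2" by (simp add: power2_norm_eq_inner)
  ultimately show ?thesis
    using p
    by (simp add: potential_affine[OF aff] conjugate_F_fun_eq[OF q f supp] inner_diff_left
        inner_diff_right algebra_simps add_divide_distrib)
qed

text \<open>By \<open>normal\<close>, \<open>- (g + h)\<close> lies in the normal cone of the
  feasible set at \<open>p\<close>. Adding it to the partial gradient
  \<open>g + (\<sigma> + l) *\<^sub>R (p - q)\<close> in the first variable cancels
  \<open>g\<close>, so the subgradient is small when \<open>p - q\<close> and \<open>h\<close> are.
  In the second variable, \<open>q\<close> is a subgradient of the conjugate.\<close>

lemma potential_subgradient:
  fixes p q g h :: "real^'n"
  assumes aff: "\<forall>i\<in>E \<union> I. \<forall>z. c i z = inner (a i) z + \<beta> i"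
    and q: "q \<in> D" and f: "\<forall>z\<in>D. f z = ereal (fr z)"
    and supp: "\<forall>z\<in>D. fr z \<le> fr q + inner g (z - q) + \<sigma> / 2 * (norm (z - q))\<^sup>2"
    and p: "p \<in> feasible_set c E I"
    and normal: "\<And>z. z \<in> feasible_set c E I \<Longrightarrow> 0 \<le> inner (g + h) (z - p)"
    and "0 \<le> \<sigma>" "0 \<le> l"
  shows "((\<sigma> + l) *\<^sub>R (p - q) - h, q - p, l *\<^sub>R (q - p))
    \<in> limiting_subdifferential (potential f c E I D \<sigma> l) (p, \<sigma> *\<^sub>R q - g, q)"
proof -
  let ?y = "\<sigma> *\<^sub>R q - g"
  let ?v = "((\<sigma> + l) *\<^sub>R (p - q) - h, q - p, l *\<^sub>R (q - p))"
  have "?v \<in> regular_subdifferential (potential f c E I D \<sigma> l) (p, ?y, q)"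
  proof (rule regular_subdifferentialI)
    show "potential f c E I D \<sigma> l (p, ?y, q)
        = ereal (fr q + inner g (p - q) + (\<sigma> + l) / 2 * (norm (p - q))\<^sup>2)"
      by (rule potential_eq[OF aff q f supp p])
  next
    fix z :: "(real^'n) \<times> (real^'n) \<times> (real^'n)"
    obtain u y w where z: "z = (u, y, w)" by (cases z) auto
    show "ereal (fr q + inner g (p - q) + (\<sigma> + l) / 2 * (norm (p - q))\<^sup>2
        + inner ?v (z - (p, ?y, q)) - (norm (z - (p, ?y, q)))\<^sup>2) \<le> potential f c E I D \<sigma> l z"
    proof (cases "u \<in> feasible_set c E I")
      case False
      have "ereal 0 + conjugate (F_fun f D \<sigma>) y \<noteq> - \<infinity>"
        using conjugate_F_fun_ge[of q D f "fr q" y \<sigma>] q f by auto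
      then show ?thesis using False by (simp add: z potential_affine[OF aff])
    next
      case True
      \<comment> \<open>The bilinear term of the potential produces this cross term of unknown sign.
        It fits into the quadratic error that \<open>regular_subdifferentialI\<close>
        permits.\<close>
      have A: "inner (y - ?y) (u - p) \<le> (norm (z - (p, ?y, q)))\<^sup>2"
      proof -
        have 1: "norm (y - ?y) \<le> norm (z - (p, ?y, q))" 
          using norm_snd_le[of "(y - ?y, w - q)" "u - p"] norm_fst_le[of "y - ?y" "w - q"]
          by (simp add: z)
        have 2: "norm (u - p) \<le> norm (z - (p, ?y, q))"
          using norm_fst_le[of "u - p" "(y - ?y, w - q)"] by (simp add: z)
        have "inner (y - ?y) (u - p) \<le> norm (y - ?y) * norm (u - p)"
          by (rule norm_cauchy_schwarz)
        also have "\<dots> \<le> (norm (z - (p, ?y, q)))\<^sup>2"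
          unfolding power2_eq_square by (intro mult_mono 1 2) auto
        finally show ?thesis .
      qed
      have B: "0 \<le> \<sigma> / 2 * (norm (u - p))\<^sup>2"
        "0 \<le> l / 2 * (norm ((u - w) - (p - q)))\<^sup>2"
        using \<open>0 \<le> \<sigma>\<close> \<open>0 \<le> l\<close> by auto
      have N: "0 \<le> inner (g + h) (u - p)" by (rule normal[OF True])
      \<comment> \<open>An exact expansion: the lower bound given by \<open>potential_ge\<close> at
        the point \<open>q\<close> exceeds the linearization by two squares and the normal cone
        term, minus the cross term.\<close>
      have "fr q + inner g (p - q) + (\<sigma> + l) / 2 * (norm (p - q))\<^sup>2
            + inner ?v (z - (p, ?y, q)) - inner (y - ?y) (u - p)
          = inner y (q - u) + fr q - \<sigma> / 2 * (norm q)\<^sup>2 + \<sigma> / 2 * (norm u)\<^sup>2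
            + l / 2 * (norm (u - w))\<^sup>2 - \<sigma> / 2 * (norm (u - p))\<^sup>2
            - l / 2 * (norm ((u - w) - (p - q)))\<^sup>2 - inner (g + h) (u - p)"
        unfolding power2_norm_eq_inner z
        by (simp add: inner_diff_left inner_diff_right inner_add_left inner_add_right
            inner_commute algebra_simps add_divide_distrib diff_divide_distrib)
      then have "fr q + inner g (p - q) + (\<sigma> + l) / 2 * (norm (p - q))\<^sup>2
            + inner ?v (z - (p, ?y, q)) - (norm (z - (p, ?y, q)))\<^sup>2
          \<le> inner y (q - u) + fr q - \<sigma> / 2 * (norm q)\<^sup>2 + \<sigma> / 2 * (norm u)\<^sup>2
            + l / 2 * (norm (u - w))\<^sup>2"
        using A B N by linarith
      then have "ereal (fr q + inner g (p - q) + (\<sigma> + l) / 2 * (norm (p - q))\<^sup>2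
            + inner ?v (z - (p, ?y, q)) - (norm (z - (p, ?y, q)))\<^sup>2)
          \<le> ereal (inner y (q - u) + fr q - \<sigma> / 2 * (norm q)\<^sup>2 + \<sigma> / 2 * (norm u)\<^sup>2
            + l / 2 * (norm (u - w))\<^sup>2)" by simp
      also have "\<dots> \<le> potential f c E I D \<sigma> l z"
        unfolding z by (rule potential_ge[where u = "fr q" and f = f, OF aff q f[rule_format, OF q]])
      finally show ?thesis .
    qed
  qed
  then show ?thesis using regular_subdifferential_subset_limiting by blast
qed

text \<open>Near the base point \<open>r \<le> 1\<close>, and then \<open>2 * \<alpha> \<le> 1\<close> gives \<open>r \<le> r powr (2 * \<alpha>)\<close>.\<close>

lemma kl_quadratic_error_bound:
  fixes h :: "'a::euclidean_space \<Rightarrow> ereal"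
  assumes KL: "kl_function_exponent h \<alpha>" and \<alpha>: "\<alpha> \<le> 1/2"
    and z: "limiting_subdifferential h z \<noteq> {}" and hz: "h z = ereal \<zeta>"
  shows "\<exists>U C \<epsilon>. open U \<and> z \<in> U \<and> 0 < \<epsilon> \<and> 0 \<le> C \<and>
    (\<forall>p\<in>U. \<forall>r v. h p = ereal (\<zeta> + r) \<and> 0 < r \<and> r < \<epsilon> \<and> v \<in> limiting_subdifferential h p \<longrightarrow>
       r \<le> C * (norm v)\<^sup>2)"
proof -
  have "0 \<le> \<alpha>" "\<alpha> < 1" using KL by (auto simp: kl_function_exponent_def)
  obtain a0 where "a0 > 0" and "kl_property_with h z (\<lambda>s. a0 * s powr (1 - \<alpha>))"
    using KL z by (auto simp: kl_function_exponent_def)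
  then obtain a U where a: "0 < a" and U: "open U" "z \<in> U"
    and ineq: "\<And>p. p \<in> U \<Longrightarrow> h z < h p \<Longrightarrow> h p < h z + a \<Longrightarrow>
      1 \<le> ereal (deriv (\<lambda>s. a0 * s powr (1 - \<alpha>)) (real_of_ereal (h p - h z)))
            * dist_zero (limiting_subdifferential h p)"
    unfolding kl_property_with_def by blast
  \<comment> \<open>\<open>a\<close> may be infinite; a positive real below it serves as the range
    of values.\<close>
  obtain \<epsilon>0 where \<epsilon>0: "0 < \<epsilon>0" "ereal \<epsilon>0 < a"
    using a by (metis ereal_dense2 ereal_less(2) less_ereal.simps(1) zero_ereal_def)
  define b where "b = a0 * (1 - \<alpha>)"
  have b: "b > 0" using \<open>a0 > 0\<close> \<open>\<alpha> < 1\<close> by (simp add: b_def)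
  have "r \<le> b\<^sup>2 * (norm v)\<^sup>2"
    if p: "p \<in> U" "h p = ereal (\<zeta> + r)" and r: "0 < r" "r < min \<epsilon>0 1"
      and v: "v \<in> limiting_subdifferential h p" for p v r
  proof -
    have "ereal r < a" using r(2) \<epsilon>0(2) by (metis less_ereal.simps(1) min_less_iff_conj order_less_trans)
    then have lt: "h z < h p" "h p < h z + a"
      using r p hz by (cases a; simp)+
    have der: "deriv (\<lambda>s. a0 * s powr (1 - \<alpha>)) r = b * r powr (- \<alpha>)"
      using r(1) by (intro DERIV_imp_deriv) (auto intro!: derivative_eq_intros simp: b_def)
    have "1 \<le> ereal (b * r powr (- \<alpha>)) * dist_zero (limiting_subdifferential h p)"
      using ineq[OF p(1) lt] p(2) hz der by simp
    \<comment> \<open>\<open>dist_zero\<close> is an infimum, so the inequality holds with any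
      single subgradient \<open>v\<close>.\<close>
    also have "\<dots> \<le> ereal (b * r powr (- \<alpha>)) * ereal (norm v)"
      using b v by (intro ereal_mult_left_mono) (auto simp: dist_zero_def intro: INF_lower)
    finally have "1 \<le> b * r powr (- \<alpha>) * norm v" by simp
    then have "r powr \<alpha> \<le> b * norm v"
      using r(1) by (simp add: powr_minus field_simps)
    then have "(r powr \<alpha>)\<^sup>2 \<le> (b * norm v)\<^sup>2"
      by (intro power_mono) auto
    moreover have "r powr 1 \<le> r powr (2 * \<alpha>)"
      using r \<alpha> by (intro powr_mono') auto
    moreover have "r powr (2 * \<alpha>) = (r powr \<alpha>)\<^sup>2"
      by (simp add: power2_eq_square flip: powr_add)
    ultimately show ?thesis using r(1) by (simp add: power_mult_distrib)
  qed
  then show ?thesis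
    using U \<epsilon>0(1) by (intro exI[of _ U] exI[of _ "b\<^sup>2"] exI[of _ "min \<epsilon>0 1"]) simp
qed

lemma feasible_set_limit:
  fixes c :: "'i \<Rightarrow> real^'n \<Rightarrow> real"
  assumes aff: "\<forall>i\<in>E \<union> I. \<forall>z. c i z = inner (a i) z + \<beta> i"
    and y: "y \<longlonglongrightarrow> z" and feas: "\<And>n::nat. y n \<in> feasible_set c E I"
  shows "z \<in> feasible_set c E I"
proof -
  have lim: "(\<lambda>n. c i (y n)) \<longlonglongrightarrow> c i z" if "i \<in> E \<union> I" for i
    using aff that by (auto intro!: tendsto_intros y)
  have "c i z = 0" if "i \<in> E" for i
    using lim[of i] feas that by (simp add: feasible_set_def LIMSEQ_const_iff)
  moreover have "0 \<le> c i z" if "i \<in> I" for i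
    using lim[of i] feas that by (intro LIMSEQ_le_const[of "\<lambda>n. c i (y n)"]) (auto simp: feasible_set_def)
  ultimately show ?thesis by (simp add: feasible_set_def)
qed

text \<open>If every constant failed, some subsequence would violate all of them, and compactness
  would give it a limit point of the pairs \<open>(x k, g k)\<close>. The Kurdyka-Lojasiewicz
  inequality at that one point is contradicted, so no version uniform over all limit points is
  called for.\<close>

lemma potential_error_bound:
  fixes c :: "'i \<Rightarrow> real^'n \<Rightarrow> real" and x g h :: "nat \<Rightarrow> real^'n"
  assumes aff: "\<forall>i\<in>E \<union> I. \<forall>z. c i z = inner (a i) z + \<beta> i"
    and D: "compact D" and f: "\<forall>z\<in>D. f z = ereal (fr z)" and cont: "continuous_on D fr"
    and x: "\<And>k. x k \<in> D" and feas: "\<And>k. x (Suc k) \<in> feasible_set c E I"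
    and supp: "\<And>k. \<forall>z\<in>D. fr z \<le> fr (x k) + inner (g k) (z - x k) + \<sigma> / 2 * (norm (z - x k))\<^sup>2"
    and g: "\<And>k. norm (g k) \<le> K" and h: "\<And>k. norm (h k) \<le> M * norm (x (Suc k) - x k)"
    and normal: "\<And>k z. z \<in> feasible_set c E I \<Longrightarrow> 0 \<le> inner (g k + h k) (z - x (Suc k))"
    and descent: "\<And>k. inner (g k) (x (Suc k) - x k)
      + (\<sigma> + l) / 2 * (norm (x (Suc k) - x k))\<^sup>2 \<le> 0"
    and pos: "0 < \<sigma>" "0 < l"
    and \<zeta>: "(\<lambda>k. fr (x k)) \<longlonglongrightarrow> \<zeta>"
    and KL: "kl_function_exponent (potential f c E I D \<sigma> l) \<alpha>" and \<alpha>: "\<alpha> \<le> 1/2"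
  shows "\<exists>C>0. \<forall>\<^sub>F k in sequentially. fr (x (Suc k)) - \<zeta> \<le> C * (norm (x (Suc k) - x k))\<^sup>2"
proof (rule ccontr)
  assume neg: "\<not> ?thesis"
  \<comment> \<open>\<open>L k\<close> is the value of the potential at the point \<open>Z k\<close>
    introduced below.\<close>
  define L where "L k = fr (x k) + inner (g k) (x (Suc k) - x k)
    + (\<sigma> + l) / 2 * (norm (x (Suc k) - x k))\<^sup>2" for k
  have L_le: "L k \<le> fr (x k)" for k using descent[of k] by (simp add: L_def)
  have L_ge: "fr (x (Suc k)) + l / 2 * (norm (x (Suc k) - x k))\<^sup>2 \<le> L k" for k
    using supp[of k] x[of "Suc k"] by (auto simp: L_def distrib_right add_divide_distrib)
  have fr_le_L: "fr (x (Suc k)) \<le> L k" for k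
  proof -
    have "0 \<le> l / 2 * (norm (x (Suc k) - x k))\<^sup>2" using pos(2) by simp
    then show ?thesis using L_ge[of k] by linarith
  qed
  have L_lim: "L \<longlonglongrightarrow> \<zeta>"
    by (intro tendsto_sandwich[OF always_eventually always_eventually LIMSEQ_Suc[OF \<zeta>] \<zeta>])
      (auto simp: L_le fr_le_L)
  \<comment> \<open>The two bounds on \<open>L k\<close> leave \<open>l / 2\<close> times the
    squared step below the decrease of \<open>fr\<close>, which tends to 0.\<close>
  have d_lim: "(\<lambda>k. x (Suc k) - x k) \<longlonglongrightarrow> 0"
  proof -
    have lim: "(\<lambda>k. 2 / l * (fr (x k) - fr (x (Suc k)))) \<longlonglongrightarrow> 2 / l * (\<zeta> - \<zeta>)"
      by (intro tendsto_intros \<zeta> LIMSEQ_Suc[OF \<zeta>])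
    have bound: "norm ((norm (x (Suc k) - x k))\<^sup>2) \<le> 2 / l * (fr (x k) - fr (x (Suc k)))" for k
    proof -
      have "l / 2 * (norm (x (Suc k) - x k))\<^sup>2 \<le> fr (x k) - fr (x (Suc k))"
        using L_ge[of k] L_le[of k] by linarith
      then show ?thesis using pos(2) by (simp add: field_simps)
    qed
    have "(\<lambda>k. (norm (x (Suc k) - x k))\<^sup>2) \<longlonglongrightarrow> 0"
    proof (rule Lim_null_comparison)
      show "\<forall>\<^sub>F k in sequentially. norm ((norm (x (Suc k) - x k))\<^sup>2)
          \<le> 2 / l * (fr (x k) - fr (x (Suc k)))"
        by (intro always_eventually allI bound)
      show "(\<lambda>k. 2 / l * (fr (x k) - fr (x (Suc k)))) \<longlonglongrightarrow> 0" using lim by simp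
    qed
    then have "(\<lambda>k. sqrt ((norm (x (Suc k) - x k))\<^sup>2)) \<longlonglongrightarrow> sqrt 0"
      by (rule tendsto_real_sqrt)
    then show ?thesis by (simp add: tendsto_norm_zero_iff)
  qed
  \<comment> \<open>The violated estimate is put in terms of \<open>L k\<close>, to which the
    Kurdyka-Lojasiewicz inequality applies; it dominates \<open>fr (x (Suc k))\<close>.\<close>
  define P where "P n k \<longleftrightarrow> real n * (norm (x (Suc k) - x k))\<^sup>2 < L k - \<zeta>" for n k
  have "\<not> (\<forall>\<^sub>F k in sequentially. \<not> P n k)" for n
  proof
    assume "\<forall>\<^sub>F k in sequentially. \<not> P n k"
    then have "\<forall>\<^sub>F k in sequentially. fr (x (Suc k)) - \<zeta> \<le> (real n + 1) * (norm (x (Suc k) - x k))\<^sup>2"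
    proof eventually_elim
      case (elim k)
      have "fr (x (Suc k)) - \<zeta> \<le> real n * (norm (x (Suc k) - x k))\<^sup>2"
        using elim fr_le_L[of k] unfolding P_def by linarith
      also have "\<dots> \<le> (real n + 1) * (norm (x (Suc k) - x k))\<^sup>2"
        by (intro mult_right_mono) auto
      finally show ?case .
    qed
    \<comment> \<open>The constant is \<open>n + 1\<close> because \<open>n\<close> itself may be
      0.\<close>
    moreover have "real n + 1 > 0" by simp
    ultimately show False using neg by blast
  qed
  then have "\<exists>r. strict_mono r \<and> (\<forall>n. P n (r n))"
    by (rule infinitely_often_subsequence)
  then obtain r where r: "strict_mono r" and P: "\<And>n. P n (r n)" by blast
  have cpt: "compact (D \<times> cball (0::real^'n) K)" using D by (intro compact_Times compact_cball)
  have "\<forall>n. (x (r n), g (r n)) \<in> D \<times> cball (0::real^'n) K"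
    using x g by simp
  from cpt[unfolded compact_def, THEN spec, THEN mp, OF this]
  obtain p s where p: "p \<in> D \<times> cball (0::real^'n) K" and s: "strict_mono s"
    and p_lim: "(\<lambda>n. (x (r (s n)), g (r (s n)))) \<longlonglongrightarrow> p" by (auto simp: o_def)
  define q where "q n = r (s n)" for n
  have q: "strict_mono q" using r s by (auto simp: q_def strict_mono_def)
  define xb gb where "xb = fst p" and "gb = snd p"
  have xb: "xb \<in> D" using p by (auto simp: xb_def)
  have x_lim: "(\<lambda>n. x (q n)) \<longlonglongrightarrow> xb" and g_lim: "(\<lambda>n. g (q n)) \<longlonglongrightarrow> gb"
    using tendsto_fst[OF p_lim] tendsto_snd[OF p_lim] by (simp_all add: q_def xb_def gb_def)
  note sub = LIMSEQ_subseq_LIMSEQ[OF _ q, unfolded o_def]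
  have dq_lim: "(\<lambda>n. x (Suc (q n)) - x (q n)) \<longlonglongrightarrow> 0"
    by (rule sub[OF d_lim])
  have xS_lim: "(\<lambda>n. x (Suc (q n))) \<longlonglongrightarrow> xb"
    using tendsto_add[OF dq_lim x_lim] by simp
  have xb_feas: "xb \<in> feasible_set c E I"
    by (rule feasible_set_limit[OF aff xS_lim]) (rule feas)
  have fr_xq: "(\<lambda>n. fr (x (q n))) \<longlonglongrightarrow> fr xb"
    using continuous_on_tendsto_compose[OF cont x_lim xb] x by simp
  have fr_xb: "fr xb = \<zeta>"
    using LIMSEQ_unique[OF fr_xq sub[OF \<zeta>]] .
  \<comment> \<open>What \<open>gb\<close> must inherit from the \<open>g k\<close> is this
    inequality, which passes to the limit by continuity.\<close>
  have supp_xb: "\<forall>z\<in>D. fr z \<le> fr xb + inner gb (z - xb) + \<sigma> / 2 * (norm (z - xb))\<^sup>2"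
  proof
    fix z assume z: "z \<in> D"
    have "(\<lambda>n. fr (x (q n)) + inner (g (q n)) (z - x (q n)) + \<sigma> / 2 * (norm (z - x (q n)))\<^sup>2)
        \<longlonglongrightarrow> fr xb + inner gb (z - xb) + \<sigma> / 2 * (norm (z - xb))\<^sup>2"
      by (intro tendsto_intros fr_xq g_lim x_lim)
    then show "fr z \<le> fr xb + inner gb (z - xb) + \<sigma> / 2 * (norm (z - xb))\<^sup>2"
      using supp z by (intro LIMSEQ_le_const) auto
  qed
  let ?\<Phi> = "potential f c E I D \<sigma> l"
  define Z where "Z k = (x (Suc k), \<sigma> *\<^sub>R x k - g k, x k)" for k
  define V where "V k = ((\<sigma> + l) *\<^sub>R (x (Suc k) - x k) - h k, x k - x (Suc k),
    l *\<^sub>R (x k - x (Suc k)))" for k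
  define zb where "zb = (xb, \<sigma> *\<^sub>R xb - gb, xb)"
  have Z_lim: "(\<lambda>n. Z (q n)) \<longlonglongrightarrow> zb"
    unfolding Z_def zb_def by (intro tendsto_intros xS_lim x_lim g_lim)
  have \<Phi>Z: "?\<Phi> (Z k) = ereal (L k)" for k
    unfolding Z_def L_def by (rule potential_eq[OF aff x f supp feas])
  have \<Phi>zb: "?\<Phi> zb = ereal \<zeta>"
    unfolding zb_def using potential_eq[OF aff xb f supp_xb xb_feas] by (simp add: fr_xb)
  have V_limiting: "V k \<in> limiting_subdifferential ?\<Phi> (Z k)" for k
    unfolding V_def Z_def using pos
    by (intro potential_subgradient[OF aff x f supp feas normal]) auto
  have V_le: "norm (V k) \<le> (\<sigma> + 2 * l + M + 1) * norm (x (Suc k) - x k)" for k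
  proof -
    have "norm (V k) \<le> norm ((\<sigma> + l) *\<^sub>R (x (Suc k) - x k) - h k)
        + (norm (x k - x (Suc k)) + norm (l *\<^sub>R (x k - x (Suc k))))"
      unfolding V_def by (intro order_trans[OF norm_Pair_le] add_left_mono norm_Pair_le)
    also have "\<dots> \<le> ((\<sigma> + l) * norm (x (Suc k) - x k) + M * norm (x (Suc k) - x k))
        + (norm (x (Suc k) - x k) + l * norm (x (Suc k) - x k))"
      using norm_triangle_ineq4[of "(\<sigma> + l) *\<^sub>R (x (Suc k) - x k)" "h k"] h[of k] pos
      by (simp add: norm_minus_commute)
    finally show ?thesis by (simp add: algebra_simps)
  qed
  \<comment> \<open>The case \<open>p = q\<close> and \<open>h = 0\<close> of
    \<open>potential_subgradient\<close>. It puts \<open>zb\<close> among the points at which the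
    Kurdyka-Lojasiewicz inequality is available.\<close>
  have "0 \<in> limiting_subdifferential ?\<Phi> zb"
  proof -
    have h_lim: "(\<lambda>n. h (q n)) \<longlonglongrightarrow> 0"
    proof (rule Lim_null_comparison)
      show "(\<lambda>n. M * norm (x (Suc (q n)) - x (q n))) \<longlonglongrightarrow> 0"
        by (intro tendsto_mult_right_zero tendsto_norm_zero dq_lim)
    qed (use h in auto)
    have "0 \<le> inner (gb + 0) (z - xb)" if "z \<in> feasible_set c E I" for z
    proof (rule LIMSEQ_le_const)
      show "(\<lambda>n. inner (g (q n) + h (q n)) (z - x (Suc (q n)))) \<longlonglongrightarrow> inner (gb + 0) (z - xb)"
        by (intro tendsto_intros g_lim h_lim xS_lim)
    qed (use normal that in auto)
    then show ?thesis
      using potential_subgradient[OF aff xb f supp_xb xb_feas, of 0 l] pos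
      by (simp add: zb_def zero_prod_def)
  qed
  then have "limiting_subdifferential ?\<Phi> zb \<noteq> {}" by blast
  from kl_quadratic_error_bound[OF KL \<alpha> this \<Phi>zb]
  obtain U C \<epsilon> where U: "open U" "zb \<in> U" and "0 < \<epsilon>" "0 \<le> C"
    and bound: "\<forall>p\<in>U. \<forall>r v. ?\<Phi> p = ereal (\<zeta> + r) \<and> 0 < r \<and> r < \<epsilon> \<and>
       v \<in> limiting_subdifferential ?\<Phi> p \<longrightarrow> r \<le> C * (norm v)\<^sup>2" by blast
  \<comment> \<open>\<open>b\<close> combines the local constant \<open>C\<close> with the ratio in
    \<open>V_le\<close>. Once \<open>n \<ge> b\<close>, also \<open>s n \<ge> b\<close>, and the
    bound contradicts \<open>P (s n)\<close>.\<close>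
  define b where "b = C * (\<sigma> + 2 * l + M + 1)\<^sup>2"
  have "\<forall>\<^sub>F n in sequentially. Z (q n) \<in> U"
    by (rule topological_tendstoD[OF Z_lim U])
  moreover have "\<forall>\<^sub>F n in sequentially. L (q n) < \<zeta> + \<epsilon>"
    using \<open>0 < \<epsilon>\<close> by (intro order_tendstoD(2)[OF sub[OF L_lim]]) simp
  moreover have "\<forall>\<^sub>F n in sequentially. b \<le> real n"
    using filterlim_real_sequentially by (simp add: filterlim_at_top)
  ultimately have "\<forall>\<^sub>F n::nat in sequentially. False"
  proof eventually_elim
    case (elim n)
    let ?d2 = "(norm (x (Suc (q n)) - x (q n)))\<^sup>2"
    have P': "real (s n) * ?d2 < L (q n) - \<zeta>"
      using P[of "s n"] by (simp add: P_def q_def)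
    moreover have "0 \<le> real (s n) * ?d2" by simp
    ultimately have "0 < L (q n) - \<zeta>" by linarith
    then have "L (q n) - \<zeta> \<le> C * (norm (V (q n)))\<^sup>2"
      using elim by (intro bound[rule_format, of "Z (q n)"]) (auto simp: \<Phi>Z V_limiting)
    also have "\<dots> \<le> C * ((\<sigma> + 2 * l + M + 1) * norm (x (Suc (q n)) - x (q n)))\<^sup>2"
      using \<open>0 \<le> C\<close> by (intro mult_left_mono power_mono V_le) auto
    also have "\<dots> = b * ?d2" by (simp add: b_def power_mult_distrib)
    also have "\<dots> \<le> real (s n) * ?d2"
      using elim seq_suble[OF s, of n] by (intro mult_right_mono) auto
    finally show False using P' by simp
  qed
  then show False by simp
qed

section \<open>Linear convergence\<close>

text \<open>Eliminating the step from \<open>descent\<close> and \<open>error\<close> contracts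
  \<open>e\<close> by the factor \<open>C / (\<kappa> + C)\<close>. The descent then bounds the
  steps by a geometric sequence, whose tails bound the distance to the limit.\<close>

lemma linear_convergence_rate:
  fixes x :: "nat \<Rightarrow> 'a::banach" and e :: "nat \<Rightarrow> real"
  assumes "\<kappa> > 0" "C > 0" and e: "\<And>k. k \<ge> N \<Longrightarrow> e k \<ge> 0"
    and descent: "\<And>k. k \<ge> N \<Longrightarrow> \<kappa> * (norm (x (Suc k) - x k))\<^sup>2 \<le> e k - e (Suc k)"
    and error: "\<And>k. k \<ge> N \<Longrightarrow> e (Suc k) \<le> C * (norm (x (Suc k) - x k))\<^sup>2"
  shows "\<exists>xbar. x \<longlonglongrightarrow> xbar \<and>
           (\<exists>q0 q1. 0 < q0 \<and> q0 < 1 \<and> 0 < q1 \<and>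
              (\<forall>\<^sub>F k in sequentially. norm (x k - xbar) \<le> q1 * q0 ^ k))"
proof -
  define q where "q = C / (\<kappa> + C)"
  have q: "0 < q" "q < 1" using assms(1,2) by (auto simp: q_def)
  have contract: "e (Suc k) \<le> q * e k" if "k \<ge> N" for k
  proof -
    have "\<kappa> * e (Suc k) \<le> \<kappa> * (C * (norm (x (Suc k) - x k))\<^sup>2)"
      using error[OF that] assms(1) by simp
    also have "\<dots> = C * (\<kappa> * (norm (x (Suc k) - x k))\<^sup>2)" by simp
    also have "\<dots> \<le> C * (e k - e (Suc k))"
      using descent[OF that] assms(2) by simp
    finally show ?thesis
      using assms(1,2) by (simp add: q_def field_simps)
  qed
  define A where "A = e N / q ^ N"
  have eA: "e k \<le> A * q ^ k" if "k \<ge> N" for k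
    using that
  proof (induction rule: dec_induct)
    case base
    then show ?case using q by (simp add: A_def)
  next
    case (step k)
    have "e (Suc k) \<le> q * (A * q ^ k)"
      using order_trans[OF contract[OF step.hyps(1)] mult_left_mono[OF step.IH]] q by simp
    then show ?case by (simp add: mult_ac)
  qed
  \<comment> \<open>The descent controls squared steps, so the steps decay with the square root of
    the ratio.\<close>
  define s where "s = sqrt q"
  have s: "0 < s" "s < 1" using q by (auto simp: s_def)
  define P where "P = sqrt (A / \<kappa>)"
  have "A \<ge> 0" using e q by (simp add: A_def)
  then have P: "P \<ge> 0" using assms(1) by (simp add: P_def)
  have d: "norm (x (Suc k) - x k) \<le> P * s ^ k" if "k \<ge> N" for k
  proof -
    have "\<kappa> * (norm (x (Suc k) - x k))\<^sup>2 \<le> A * q ^ k"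
      using descent[OF that] eA[OF that] e[of "Suc k"] that by linarith
    then have "(norm (x (Suc k) - x k))\<^sup>2 \<le> A / \<kappa> * q ^ k"
      using assms(1) by (simp add: field_simps)
    then have "norm (x (Suc k) - x k) \<le> sqrt (A / \<kappa> * q ^ k)"
      by (rule real_le_rsqrt)
    then show ?thesis
      by (simp only: P_def s_def real_sqrt_mult[of "A / \<kappa>"] real_sqrt_power)
  qed
  have "summable (\<lambda>k. x (Suc k) - x k)"
  proof (rule summable_comparison_test)
    show "\<exists>N. \<forall>n\<ge>N. norm (x (Suc n) - x n) \<le> P * s ^ n" using d by blast
    show "summable (\<lambda>k. P * s ^ k)" using s by (intro summable_mult summable_geometric) auto
  qed
  then have "convergent (\<lambda>n. (\<Sum>k<n. x (Suc k) - x k))"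
    by (simp add: summable_iff_convergent)
  then have "convergent (\<lambda>n. x n - x 0)"
    by (simp add: sum_lessThan_telescope)
  then obtain L where "(\<lambda>n. x n - x 0) \<longlonglongrightarrow> L" by (auto simp: convergent_def)
  from tendsto_add[OF this tendsto_const[of "x 0"]]
  have lim: "x \<longlonglongrightarrow> L + x 0" by simp
  \<comment> \<open>The factor \<open>1 - s ^ j\<close> is the closed form of the finite geometric
    sum, which makes the induction exact.\<close>
  have geo: "norm (x (k + j) - x k) \<le> P / (1 - s) * s ^ k * (1 - s ^ j)" if "k \<ge> N" for k j
  proof (induction j)
    case (Suc j)
    have "norm (x (k + Suc j) - x k) \<le> norm (x (Suc (k + j)) - x (k + j)) + norm (x (k + j) - x k)"
      using norm_triangle_ineq[of "x (Suc (k + j)) - x (k + j)" "x (k + j) - x k"] by simp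
    also have "\<dots> \<le> P * s ^ (k + j) + P / (1 - s) * s ^ k * (1 - s ^ j)"
      using d[of "k + j"] Suc that by simp
    also have "P * s ^ (k + j) = P / (1 - s) * s ^ k * (s ^ j * (1 - s))"
      using s by (simp add: power_add)
    also have "\<dots> + P / (1 - s) * s ^ k * (1 - s ^ j) = P / (1 - s) * s ^ k * (1 - s ^ Suc j)"
    proof -
      have "s ^ j * (1 - s) + (1 - s ^ j) = 1 - s ^ Suc j" by (simp add: algebra_simps)
      then show ?thesis by (simp only: distrib_left[symmetric])
    qed
    finally show ?case .
  qed simp
  \<comment> \<open>Adding 1 keeps the constant positive when \<open>P = 0\<close>.\<close>
  have "norm (x k - (L + x 0)) \<le> (P / (1 - s) + 1) * s ^ k" if "k \<ge> N" for k
  proof -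
    have "norm (x (j + k) - x k) \<le> (P / (1 - s) + 1) * s ^ k" for j
    proof -
      have "P / (1 - s) * s ^ k * (1 - s ^ j) \<le> P / (1 - s) * s ^ k"
        using P s by (intro mult_left_le) (auto intro!: divide_nonneg_pos mult_nonneg_nonneg)
      also have "\<dots> \<le> (P / (1 - s) + 1) * s ^ k"
        using s by (simp add: distrib_right)
      finally show ?thesis using geo[OF that, of j] by (simp add: add.commute)
    qed
    moreover have "(\<lambda>j. norm (x (j + k) - x k)) \<longlonglongrightarrow> norm (L + x 0 - x k)"
      by (intro tendsto_intros LIMSEQ_ignore_initial_segment[OF lim])
    ultimately have "norm (L + x 0 - x k) \<le> (P / (1 - s) + 1) * s ^ k"
      by (intro LIMSEQ_le_const2) auto
    then show ?thesis by (simp add: norm_minus_commute)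
  qed
  then have "\<forall>\<^sub>F k in sequentially. norm (x k - (L + x 0)) \<le> (P / (1 - s) + 1) * s ^ k"
    by (auto simp: eventually_sequentially)
  moreover have "0 < P / (1 - s) + 1" using P s by (simp add: add_nonneg_pos)
  ultimately show ?thesis using lim s by blast
qed

theorem theorem5p11:
  fixes f :: "real^'n \<Rightarrow> ereal"
    and c :: "'i \<Rightarrow> real^'n \<Rightarrow> real"
    and E I :: "'i set"
    and D :: "(real^'n) set"
    and x g d :: "nat \<Rightarrow> real^'n"
    and B :: "nat \<Rightarrow> real^'n^'n"
    and v w t lam :: "nat \<Rightarrow> 'i \<Rightarrow> real"
    and \<theta> step :: "nat \<Rightarrow> real"
    and \<theta>0 \<eta> \<tau> \<gamma> \<rho> H b \<sigma> l \<alpha> :: real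
  assumes index_sets: "finite E" "finite I" "E \<inter> I = {}"
    and f_proper: "\<And>z. f z \<noteq> - \<infinity>"
    and A1: "assumption_A1 TYPE('t) f D \<rho>"
    and A2: "assumption_A2 c (E \<union> I) H"
    and A3: "assumption_A3 (feasible_set c E I) D x d B b"
    and run: "sqp_run f c E I \<theta>0 \<eta> \<tau> \<gamma> x g B d v w t lam \<theta> step"
    and MFCQ: "\<And>z. accumulation_point x z \<Longrightarrow> mfcq c E I z"
    and affine_constraints: "\<And>i. i \<in> E \<union> I \<Longrightarrow> affine_function (c i)"
    and potential_constants: "0 < \<sigma>" "0 < l" "convex_extended (F_fun f D \<sigma>)"
    and constants: "b \<ge> \<sigma>" "\<sigma> \<ge> \<rho>" "2 * b \<ge> \<sigma> + l"
    and alpha: "0 < \<alpha>" "\<alpha> \<le> 1/2"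
    and KL: "kl_function_exponent (potential f c E I D \<sigma> l) \<alpha>"
  shows "\<exists>xbar. x \<longlonglongrightarrow> xbar \<and>
           (\<exists>q0 q1. 0 < q0 \<and> q0 < 1 \<and> 0 < q1 \<and>
              (\<forall>\<^sub>F k in sequentially. norm (x k - xbar) \<le> q1 * q0 ^ k))"
proof -

  \<comment> \<open>Data of the run and the quadratic upper model of the objective\<close>
  note A1' = A1[unfolded assumption_A1_def]
  from A1'[THEN conjunct1]
  obtain U Kf where U: "open U" "D \<subseteq> U" and fin: "\<And>z. z \<in> U \<Longrightarrow> \<bar>f z\<bar> \<noteq> \<infinity>"
    and lip: "Kf-lipschitz_on U (\<lambda>z. real_of_ereal (f z))"
    by (elim exE conjE) (rule that; simp)
  have f_upper: "f z - f y - ereal (inner u (z - y)) \<le> ereal (\<rho> / 2 * (norm (z - y))\<^sup>2)"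
    if "z \<in> D" "y \<in> D" "u \<in> clarke_subdifferential f y" for z y u
    using A1'[THEN conjunct2, THEN conjunct2, THEN conjunct2, rule_format, OF that] .
  define fr where "fr z = real_of_ereal (f z)" for z
  have f: "\<forall>z\<in>D. f z = ereal (fr z)"
  proof
    fix z assume "z \<in> D"
    then have "z \<in> U" using U(2) by (rule subsetD[rotated])
    then show "f z = ereal (fr z)" using fin[of z] by (simp add: fr_def ereal_real)
  qed
  note A3' = A3[unfolded assumption_A3_def]
  have D: "compact D" and xD: "x k \<in> D" and dD: "x k + d k \<in> D"
    and B_bdd: "bounded (range B)" and "0 < b"
    and B_pos: "b * (norm u)\<^sup>2 \<le> inner u (B k *v u)" for k u
    using A3' by simp_all
  have cont: "continuous_on D fr"
    unfolding fr_def
    by (rule continuous_on_subset[OF lipschitz_on_continuous_on[OF lip] U(2)])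
  note run' = run[unfolded sqp_run_def]
  have \<theta>0: "0 < \<theta>0" "\<theta> 0 = \<theta>0" and \<eta>: "0 < \<eta>" "\<eta> < 1" and "0 < \<gamma>"
    using run' by - (elim conjE, assumption)+
  note iter = run'[THEN conjunct2, THEN conjunct2, THEN conjunct2, THEN conjunct2, THEN conjunct2,
      THEN conjunct2, THEN conjunct2, THEN spec]
  have g: "g k \<in> clarke_subdifferential f (x k)"
    and qp: "qp_solution f c E I (x k) (g k) (B k) (\<theta> k) (d k) (v k) (w k) (t k)"
    and mult: "qp_multiplier c E I (x k) (g k) (B k) (\<theta> k) (d k) (v k) (w k) (t k) (lam (Suc k))"
    and \<theta>: "\<theta> (Suc k) = max (\<theta> k) (max_norm (E \<union> I) (lam (Suc k)) + \<gamma>)"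
    and line: "\<exists>j. step k = \<tau> ^ j \<and>
               sufficient_decrease f c E I \<eta> (x k) (\<theta> k) (d k) (B k) (\<tau> ^ j) \<and>
               (\<forall>j'<j. \<not> sufficient_decrease f c E I \<eta> (x k) (\<theta> k) (d k) (B k) (\<tau> ^ j'))"
    and x_step: "x (Suc k) = x k + step k *\<^sub>R d k" for k
    using iter[of k] by - (elim conjE, assumption)+
  have feas: "qp_feasible c E I (x k) (d k) (v k) (w k) (t k)" for k
    using qp[of k] by (simp add: qp_solution_def)
  have "\<forall>i\<in>E \<union> I. \<exists>a \<beta>. \<forall>z. c i z = inner a z + \<beta>"
    using affine_constraints unfolding affine_function_def by blast
  then obtain a \<beta> where aff: "\<forall>i\<in>E \<union> I. \<forall>z. c i z = inner (a i) z + \<beta> i"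
    by metis
  have affD: "c i z = inner (a i) z + \<beta> i" if "i \<in> E \<union> I" for i z
    using aff that by blast
  have grad: "grad (c i) z = a i" if "i \<in> E \<union> I" for i z
    by (rule grad_affine) (rule affD[OF that])
  have \<theta>_pos: "0 < \<theta> k" for k
    by (induction k) (use \<theta>0 \<theta> in \<open>auto simp: less_max_iff_disj\<close>)
  have supp_\<rho>: "fr z \<le> fr (x k) + inner (g k) (z - x k) + \<rho> / 2 * (norm (z - x k))\<^sup>2"
    if "z \<in> D" for z k
    using f_upper[OF that xD g, of k] f that xD[of k] by simp
  have supp: "\<forall>z\<in>D. fr z \<le> fr (x k) + inner (g k) (z - x k) + \<sigma> / 2 * (norm (z - x k))\<^sup>2" for k
  proof
    fix z assume "z \<in> D"
    moreover have "\<rho> / 2 * (norm (z - x k))\<^sup>2 \<le> \<sigma> / 2 * (norm (z - x k))\<^sup>2"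
      using constants by (intro mult_right_mono) auto
    ultimately show "fr z \<le> fr (x k) + inner (g k) (z - x k) + \<sigma> / 2 * (norm (z - x k))\<^sup>2"
      using supp_\<rho>[of z k] by linarith
  qed

  \<comment> \<open>Acceptance of the full step\<close>
  have step1: "step k = 1" for k
  proof -
    let ?q = "inner (d k) (B k *v d k)"
    have "inner (g k) (d k) + ?q
        \<le> \<theta> k * (violation c E I (x k) - violation c E I (x k + d k))"
      using \<theta>_pos[of k] by (intro affine_qp_step[OF index_sets affD feas mult]) auto
    moreover have "fr (x k + d k) \<le> fr (x k) + inner (g k) (d k) + \<sigma> / 2 * (norm (d k))\<^sup>2"
      using supp[of k] dD[of k] by fastforce
    moreover have "\<sigma> / 2 * (norm (d k))\<^sup>2 \<le> b / 2 * (norm (d k))\<^sup>2"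
      using constants by (intro mult_right_mono) auto
    moreover have "b * (norm (d k))\<^sup>2 \<le> ?q" by (rule B_pos)
    \<comment> \<open>\<open>affine_qp_step\<close> supplies a decrease of \<open>?q\<close>, of
      which the upper model consumes at most half because \<open>\<sigma> \<le> b\<close>.\<close>
    ultimately have "1/2 * ?q \<le> fr (x k) + \<theta> k * violation c E I (x k)
        - (fr (x k + d k) + \<theta> k * violation c E I (x k + d k))"
      by (simp add: right_diff_distrib)
    moreover have "\<eta> * (1/2 * ?q) \<le> 1/2 * ?q"
      using \<eta> order_trans[OF _ B_pos, of 0 "d k" k] \<open>0 < b\<close> by (intro mult_left_le_one_le) auto
    ultimately have "sufficient_decrease f c E I \<eta> (x k) (\<theta> k) (d k) (B k) (\<tau> ^ 0)"
      using f xD[of k] dD[of k] by (simp add: sufficient_decrease_def merit_def)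
    \<comment> \<open>\<open>\<tau> ^ 0\<close> is the first trial value, so the minimal exponent is
      0.\<close>
    then show ?thesis using line[of k] by (metis not_gr_zero power_0)
  qed
  then have x_Suc: "x (Suc k) = x k + d k" for k
    using x_step by simp
  have d_eq: "d k = x (Suc k) - x k" for k by (simp add: x_Suc)
  have c_Suc: "c i (x k) + inner (grad (c i) (x k)) (d k) = c i (x (Suc k))" if "i \<in> E \<union> I" for i k
    by (simp add: x_Suc grad[OF that] affD[OF that] inner_add_right)

  \<comment> \<open>Bounds on the multipliers and the penalties\<close>
  have g_bound: "norm (g k) \<le> Kf" for k
    using clarke_subdifferential_bounded[OF U(1) _ fin lip g] xD U(2) by blast
  obtain M0 where M0: "\<And>k. norm (B k) \<le> M0" and "0 < M0"
    using B_bdd unfolding bounded_pos by auto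
  define M where "M = real CARD('n) * M0"
  have "0 \<le> M" using \<open>0 < M0\<close> by (simp add: M_def)
  have Bd: "norm (B k *v u) \<le> M * norm u" for k u
  proof -
    have "norm (B k *v u) \<le> real CARD('n) * norm (B k) * norm u"
      by (rule norm_matrix_vector_mult_le)
    also have "\<dots> \<le> M * norm u"
      unfolding M_def by (intro mult_right_mono mult_left_mono M0) auto
    finally show ?thesis .
  qed
  obtain R where R: "\<And>z. z \<in> D \<Longrightarrow> norm z \<le> R"
    using compact_imp_bounded[OF D] unfolding bounded_iff by blast
  have stat: "(\<Sum>i\<in>E \<union> I. lam (Suc k) i *\<^sub>R a i) = g k + B k *v d k" for k
    using mult[of k] by (simp add: qp_multiplier_def grad)
  have lam_I: "0 \<le> lam (Suc k) i \<and> lam (Suc k) i * (c i (x (Suc k)) + t k i) = 0"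
    if "i \<in> I" for i k
    using mult[of k, unfolded qp_multiplier_def, THEN conjunct2, THEN conjunct1, THEN bspec, OF that]
      c_Suc[of i k] that by simp
  have "norm (g k + B k *v d k) \<le> Kf + M * (R + R)" for k
  proof -
    have "norm (d k) \<le> R + R"
      unfolding d_eq using norm_triangle_ineq4[of "x (Suc k)" "x k"] R[OF xD] by (smt (verit))
    then have "norm (B k *v d k) \<le> M * (R + R)"
      using Bd[of k "d k"] \<open>0 \<le> M\<close> by (meson mult_left_mono order_trans)
    then show ?thesis using norm_triangle_ineq[of "g k" "B k *v d k"] g_bound[of k] by linarith
  qed
  \<comment> \<open>A positive multiplier forces \<open>c i (x (Suc k)) = - t k i\<close>. The slack
    may still be positive at this stage, so only an inequality results.\<close>
  moreover have "c i (x (Suc k)) \<le> 0" if "i \<in> I" "0 < lam (Suc k) i" for k i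
    using lam_I[OF that(1), of k] that feas[of k] by (auto simp: qp_feasible_def)
  ultimately obtain R' where R': "\<forall>\<^sub>F k in sequentially. \<forall>i\<in>E \<union> I. \<bar>lam (Suc k) i\<bar> \<le> R'"
    using mfcq_multipliers_bounded[of E I c a \<beta> D "\<lambda>k. x (Suc k)" "\<lambda>k. lam (Suc k)"
        "\<lambda>k. g k + B k *v d k" "Kf + M * (R + R)"]
      index_sets affD D xD MFCQ accumulation_point_Suc[of x] stat lam_I by blast
  have "\<forall>\<^sub>F k in sequentially. max_norm (E \<union> I) (lam (Suc k)) \<le> max 0 R'"
    using R' index_sets
    by (auto elim!: eventually_mono intro!: max_norm_le simp: le_max_iff_disj)
  from penalty_exceeds_multipliers[OF \<theta> this \<open>0 < \<gamma>\<close>]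
  obtain N where N: "\<And>k. k \<ge> N \<Longrightarrow> max_norm (E \<union> I) (lam (Suc k)) < \<theta> k"
    by (auto simp: eventually_sequentially)

  \<comment> \<open>Feasibility and normality of the late iterates\<close>
  have lam_less: "\<bar>lam (Suc k) i\<bar> < \<theta> k" if "k \<ge> N" "i \<in> E \<union> I" for k i
    using N[OF that(1)] abs_le_max_norm[OF _ that(2), of "lam (Suc k)"] index_sets by simp
  \<comment> \<open>Multipliers strictly below the penalty make the multipliers of the sign
    constraints on the slacks positive, so complementarity forces the slacks to 0.\<close>
  have slack_E: "v k i = 0 \<and> w k i = 0" if "k \<ge> N" "i \<in> E" for k i
    using mult[of k] lam_less[of k i] that unfolding qp_multiplier_def by fastforce
  have slack_I: "t k i = 0" if "k \<ge> N" "i \<in> I" for k i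
    using mult[of k] lam_less[of k i] that unfolding qp_multiplier_def by fastforce
  have feasible: "x (Suc k) \<in> feasible_set c E I" if "k \<ge> N" for k
    using feas[of k] slack_E[OF that] slack_I[OF that] c_Suc
    unfolding qp_feasible_def feasible_set_def by fastforce
  \<comment> \<open>Equality terms vanish because both points are feasible. An inequality term can
    be nonzero only where the constraint is active at \<open>x (Suc k)\<close>, and there it is
    nonnegative.\<close>
  have normal: "0 \<le> inner (g k + B k *v d k) (z - x (Suc k))"
    if k: "k \<ge> N" and z: "z \<in> feasible_set c E I" for k z
  proof -
    have "0 \<le> lam (Suc k) i * inner (a i) (z - x (Suc k))" if i: "i \<in> E \<union> I" for i
    proof -
      have eq: "inner (a i) (z - x (Suc k)) = c i z - c i (x (Suc k))"
        by (simp add: affD[OF i] inner_diff_right)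
      show ?thesis
      proof (cases "i \<in> E")
        case True
        then show ?thesis using z feasible[OF k] by (simp add: eq feasible_set_def)
      next
        case False
        then have "i \<in> I" using i by simp
        then show ?thesis
          using z lam_I[of i k] slack_I[OF k] by (auto simp: eq feasible_set_def)
      qed
    qed
    then show ?thesis
      unfolding stat[symmetric] inner_sum_left inner_scaleR_left by (intro sum_nonneg)
  qed
  \<comment> \<open>From \<open>Suc N\<close> on, \<open>x k\<close> is itself feasible and may be
    inserted for \<open>z\<close> in \<open>normal\<close>. The bound
    \<open>2 * b \<ge> \<sigma> + l\<close> enters here.\<close>
  have descent: "inner (g k) (d k) + (\<sigma> + l) / 2 * (norm (d k))\<^sup>2 \<le> 0" if "k \<ge> Suc N" for k
  proof -
    have "x k \<in> feasible_set c E I" using feasible[of "k - 1"] that by simp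
    then have "0 \<le> inner (g k + B k *v d k) (- d k)"
      using normal[of k "x k"] that by (simp add: d_eq)
    moreover have "(\<sigma> + l) / 2 * (norm (d k))\<^sup>2 \<le> b * (norm (d k))\<^sup>2"
      using constants by (intro mult_right_mono) auto
    ultimately show ?thesis
      using B_pos[of "d k" k] by (simp add: inner_add_left inner_commute[of "B k *v d k"])
  qed

  \<comment> \<open>Monotone values, error bound and rate for the tail\<close>
  have fr_descent: "l / 2 * (norm (d k))\<^sup>2 \<le> fr (x k) - fr (x (Suc k))" if "k \<ge> Suc N" for k
    using descent[OF that] supp[of k] xD[of "Suc k"]
    by (auto simp: x_Suc distrib_right add_divide_distrib)
  \<comment> \<open>The shift makes feasibility and descent hold at every index, as
    \<open>potential_error_bound\<close> requires.\<close>
  define X where "X k = x (k + Suc N)" for k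
  have dec: "decseq (\<lambda>k. fr (X k))"
  proof (rule decseq_SucI)
    fix k
    have "0 \<le> l / 2 * (norm (d (k + Suc N)))\<^sup>2" using potential_constants by simp
    then show "fr (X (Suc k)) \<le> fr (X k)"
      using fr_descent[of "k + Suc N"] by (simp add: X_def)
  qed
  obtain m where "\<And>k. m \<le> fr (X k)"
  proof -
    have "bounded (fr ` D)"
      by (intro compact_imp_bounded compact_continuous_image cont D)
    then obtain m where "\<And>z. z \<in> D \<Longrightarrow> \<bar>fr z\<bar> \<le> m"
      unfolding bounded_iff by auto
    then have "- m \<le> fr (X k)" for k
      using xD[of "k + Suc N"] unfolding X_def by (smt (verit))
    then show thesis by (rule that)
  qed
  then have "\<forall>k. m \<le> fr (X k)" by blast
  from decseq_convergent[OF dec this]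
  obtain \<zeta> where \<zeta>: "(\<lambda>k. fr (X k)) \<longlonglongrightarrow> \<zeta>" and \<zeta>_le: "\<forall>k. \<zeta> \<le> fr (X k)"
    by blast
  have "\<exists>C>0. \<forall>\<^sub>F k in sequentially. fr (X (Suc k)) - \<zeta> \<le> C * (norm (X (Suc k) - X k))\<^sup>2"
  \<comment> \<open>The correction is \<open>h = B d\<close>: stationarity makes
    \<open>g + h\<close> satisfy \<open>normal\<close>, and the uniform bound on the matrices makes
    \<open>h\<close> of the order of the step.\<close>
  proof (rule potential_error_bound[OF aff D f cont,
        where x = X and g = "\<lambda>k. g (k + Suc N)" and h = "\<lambda>k. B (k + Suc N) *v d (k + Suc N)"])
    show "norm (B (k + Suc N) *v d (k + Suc N)) \<le> M * norm (X (Suc k) - X k)" for k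
      using Bd by (simp add: X_def d_eq)
    show "inner (g (k + Suc N)) (X (Suc k) - X k) + (\<sigma> + l) / 2 * (norm (X (Suc k) - X k))\<^sup>2 \<le> 0" for k
      using descent[of "k + Suc N"] by (simp add: X_def d_eq)
    show "X (Suc k) \<in> feasible_set c E I" for k
      using feasible[of "k + Suc N"] by (simp add: X_def)
    show "0 \<le> inner (g (k + Suc N) + B (k + Suc N) *v d (k + Suc N)) (z - X (Suc k))"
      if "z \<in> feasible_set c E I" for k z
      using normal[OF _ that, of "k + Suc N"] by (simp add: X_def)
  qed (use xD supp g_bound potential_constants \<zeta> KL alpha in \<open>auto simp: X_def\<close>)
  then obtain C N' where "C > 0"
    and C: "\<And>k. k \<ge> N' \<Longrightarrow> fr (X (Suc k)) - \<zeta> \<le> C * (norm (X (Suc k) - X k))\<^sup>2"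
    by (auto simp: eventually_sequentially)
  show ?thesis
  \<comment> \<open>\<open>\<kappa> = l / 2\<close> comes from \<open>fr_descent\<close> and
    \<open>C\<close> from the error bound. Undoing the shift turns the threshold \<open>N'\<close>
    for \<open>X\<close> into \<open>N' + Suc N\<close> for \<open>x\<close>.\<close>
  proof (rule linear_convergence_rate[where e = "\<lambda>k. fr (x k) - \<zeta>" and \<kappa> = "l / 2" and C = C])
    fix k assume "k \<ge> N' + Suc N"
    then obtain j where j: "k = j + Suc N" "j \<ge> N'"
      by (metis add_le_imp_le_right le_add_diff_inverse2 add_leD2)
    show "0 \<le> fr (x k) - \<zeta>" using spec[OF \<zeta>_le, of j] j by (simp add: X_def)
    show "l / 2 * (norm (x (Suc k) - x k))\<^sup>2 \<le> fr (x k) - \<zeta> - (fr (x (Suc k)) - \<zeta>)"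
      using fr_descent[of k] j by (simp add: d_eq)
    show "fr (x (Suc k)) - \<zeta> \<le> C * (norm (x (Suc k) - x k))\<^sup>2"
      using C[OF j(2)] j by (simp add: X_def)
  qed (use potential_constants \<open>C > 0\<close> in auto)
qed

end
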